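(* Let $p$ be a prime, $n$ a natural number and $G=\mathbb{Z}^n\ltimes \mathrm{UT}_n(\mathbb{Z}[1/p])$. Let $\mu$ be a probability measure on $G$ that has finite first moment with respect to word length and such that the group generated by $\operatorname{supp}\mu$ is non-abelian. Let $D$ be the displacement matrix associated with $\mu$. Let $i<j\le n$ be natural numbers such that $D_{ij}$ is positive and $\operatorname{sgn}(D_{ij})=\operatorname{sgn}(D_{kj})$ for all natural numbers $k$ with $i<k<j$. Let $(y^{(m)},\varphi^{(m)})$, $m\ge1$, be the path of the right random walk associated with $\mu$. Then the sequence $(\varphi^{(m)}_{ij})_{m\ge 1}$ is almost surely convergent in $\mathbb{Q}_p$.
   Context: $\mathrm{UT}_n(R)$ is the group of upper unitriangular $n\times n$ matrices over $R$. The product in $G$ is $(x,f)(y,g)=(x+y,\,f\,XgX^{-1})$, where $X=\operatorname{diag}(p^{x_1},\dots,p^{x_n})$ for $x=(x_1,\dots,x_n)\in\mathbb{Z}^n$. $G$ is a finitely generated discrete group; word length $|\cdot|$ is taken with respect to a finite generating set, and finite first moment means $\int_G|g|\,d\mu(g)<\infty$. For $1\le i\le n$, $\mu_i$ is the pushforward of $\mu$ under $(x,f)\mapsto x_i$, and $m_1(\mu_i)=\int_{\mathbb{Z}} z\,d\mu_i(z)$. The displacement matrix $D$ has entries $D_{ij}=m_1(\mu_i)-m_1(\mu_j)$ for $i<j$. The right random walk: $(x^{(k)},f^{(k)})_{k\ge1}$ are independent with common law $\mu$, and $(y^{(m)},\varphi^{(m)})=(x^{(1)},f^{(1)})(x^{(2)},f^{(2)})\cdots(x^{(m)},f^{(m)})$.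 *)

theory Defs
  imports
    "HOL-Probability.Probability"
    "HOL-Algebra.Elementary_Groups"
    "HOL-Computational_Algebra.Primes"
    "Jordan_Normal_Form.Determinant"
begin

unbundle no vec_syntax

context Metric_space
begin

definition null_rel :: "((nat \<Rightarrow> 'a) \<times> (nat \<Rightarrow> 'a)) set" where
  "null_rel = {(s, t). MCauchy s \<and> MCauchy t \<and> (\<lambda>k. d (s k) (t k)) \<longlonglongrightarrow> 0}"

definition completion :: "(nat \<Rightarrow> 'a) set set" where
  "completion = {s. MCauchy s} // null_rel"

text \<open>The representatives may be chosen arbitrarily, see \<open>completion_dist_eq\<close>. Outside the carrier
  the value is 0 because the locale wants distances to be nonnegative and symmetric everywhere.\<close>

definition completion_dist :: "(nat \<Rightarrow> 'a) set \<Rightarrow> (nat \<Rightarrow> 'a) set \<Rightarrow> real" where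
  "completion_dist A B =
     (if A \<in> completion \<and> B \<in> completion
      then lim (\<lambda>k. d ((SOME s. s \<in> A) k) ((SOME t. t \<in> B) k)) else 0)"

definition to_completion :: "'a \<Rightarrow> (nat \<Rightarrow> 'a) set" where
  "to_completion x = null_rel `` {\<lambda>_. x}"

lemma MCauchy_M: "MCauchy s \<Longrightarrow> s k \<in> M"
  by (auto simp: MCauchy_def)

lemma dist_diff_le:
  assumes "x \<in> M" "y \<in> M" "x' \<in> M" "y' \<in> M"
  shows "\<bar>d x y - d x' y'\<bar> \<le> d x x' + d y y'"
  using assms triangle[of x x' y] triangle[of x' y' y] triangle[of x' x y'] triangle[of x y y']
    commute[of x x'] commute[of y y'] by linarith

lemma MCauchy_dist_convergent:
  assumes "MCauchy s" "MCauchy t"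
  shows "convergent (\<lambda>k. d (s k) (t k))"
proof -
  have "Cauchy (\<lambda>k. d (s k) (t k))"
  proof (rule metric_CauchyI)
    fix e :: real assume e: "e > 0"
    then obtain N1 where N1: "\<And>m k. m \<ge> N1 \<Longrightarrow> k \<ge> N1 \<Longrightarrow> d (s m) (s k) < e/2"
      using assms(1) half_gt_zero[OF e] unfolding MCauchy_def by blast
    obtain N2 where N2: "\<And>m k. m \<ge> N2 \<Longrightarrow> k \<ge> N2 \<Longrightarrow> d (t m) (t k) < e/2"
      using assms(2) half_gt_zero[OF e] unfolding MCauchy_def by blast
    show "\<exists>N. \<forall>m\<ge>N. \<forall>k\<ge>N. dist (d (s m) (t m)) (d (s k) (t k)) < e"
    proof (intro exI[of _ "max N1 N2"] allI impI)
      fix m k assume "m \<ge> max N1 N2" "k \<ge> max N1 N2"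
      then have "d (s m) (s k) < e/2" "d (t m) (t k) < e/2" using N1 N2 by auto
      moreover have "\<bar>d (s m) (t m) - d (s k) (t k)\<bar> \<le> d (s m) (s k) + d (t m) (t k)"
        using assms by (intro dist_diff_le) (auto intro: MCauchy_M)
      ultimately show "dist (d (s m) (t m)) (d (s k) (t k)) < e"
        by (simp add: dist_real_def)
    qed
  qed
  then show ?thesis by (rule Cauchy_convergent)
qed

lemma equiv_null_rel: "equiv {s. MCauchy s} null_rel"
proof (rule equivI)
  show "null_rel \<subseteq> {s. MCauchy s} \<times> {s. MCauchy s}" by (auto simp: null_rel_def)
  show "refl_on {s. MCauchy s} null_rel"
    by (auto simp: refl_on_def null_rel_def MCauchy_M)
  show "sym null_rel"
    by (auto simp: sym_def null_rel_def commute)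
  show "trans null_rel"
  proof (rule transI)
    fix s t u assume "(s, t) \<in> null_rel" "(t, u) \<in> null_rel"
    then have C: "MCauchy s" "MCauchy t" "MCauchy u"
      and l: "(\<lambda>k. d (s k) (t k)) \<longlonglongrightarrow> 0" "(\<lambda>k. d (t k) (u k)) \<longlonglongrightarrow> 0"
      by (auto simp: null_rel_def)
    have "(\<lambda>k. d (s k) (t k) + d (t k) (u k)) \<longlonglongrightarrow> 0"
      using tendsto_add[OF l] by simp
    then have "(\<lambda>k. d (s k) (u k)) \<longlonglongrightarrow> 0"
      by (rule Lim_null_comparison[rotated])
        (auto simp: MCauchy_M C intro!: always_eventually triangle)
    then show "(s, u) \<in> null_rel" using C by (simp add: null_rel_def)
  qed
qed

lemma completion_memD:
  assumes "A \<in> completion" "s \<in> A"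
  shows "MCauchy s" "A = null_rel `` {s}"
proof -
  obtain t where t: "A = null_rel `` {t}" "MCauchy t"
    using assms(1) unfolding completion_def by (auto elim: quotientE)
  then have ts: "(t, s) \<in> null_rel" using assms(2) by auto
  then show "MCauchy s" by (simp add: null_rel_def)
  show "A = null_rel `` {s}" using equiv_class_eq[OF equiv_null_rel ts] t by simp
qed

lemma completion_ex: "A \<in> completion \<Longrightarrow> \<exists>s. s \<in> A"
  unfolding completion_def
  using equiv_class_self[OF equiv_null_rel] by (auto elim!: quotientE)

lemma completion_dist_eq:
  assumes A: "A \<in> completion" "s \<in> A" and B: "B \<in> completion" "t \<in> B"
  shows "(\<lambda>k. d (s k) (t k)) \<longlonglongrightarrow> completion_dist A B"
proof -
  define s' t' where "s' = (SOME s. s \<in> A)" and "t' = (SOME t. t \<in> B)"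
  have s': "s' \<in> A" unfolding s'_def using someI[of "\<lambda>s. s \<in> A", OF A(2)] .
  have t': "t' \<in> B" unfolding t'_def using someI[of "\<lambda>t. t \<in> B", OF B(2)] .
  note C = completion_memD(1)[OF A] completion_memD(1)[OF B]
    completion_memD(1)[OF A(1) s'] completion_memD(1)[OF B(1) t']
  have 1: "(\<lambda>k. d (s' k) (t' k)) \<longlonglongrightarrow> completion_dist A B"
    using MCauchy_dist_convergent[OF C(3,4)] A B
    by (simp add: completion_dist_def convergent_LIMSEQ_iff s'_def t'_def)
  have "(s, s') \<in> null_rel" "(t, t') \<in> null_rel"
    using completion_memD(2)[OF A] completion_memD(2)[OF B] s' t' by auto
  then have l: "(\<lambda>k. d (s k) (s' k)) \<longlonglongrightarrow> 0" "(\<lambda>k. d (t k) (t' k)) \<longlonglongrightarrow> 0"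
    by (auto simp: null_rel_def)
  have l': "(\<lambda>k. d (s k) (s' k) + d (t k) (t' k)) \<longlonglongrightarrow> 0"
    using tendsto_add[OF l] by simp
  have "(\<lambda>k. d (s k) (t k) - d (s' k) (t' k)) \<longlonglongrightarrow> 0"
    by (rule Lim_null_comparison[OF _ l'])
      (auto intro!: always_eventually dist_diff_le MCauchy_M C)
  from tendsto_add[OF this 1] show ?thesis by simp
qed

lemma Metric_space_completion: "Metric_space completion completion_dist"
proof
  show nn: "0 \<le> completion_dist A B" for A B
  proof (cases "A \<in> completion \<and> B \<in> completion")
    case True
    then obtain s t where st: "s \<in> A" "t \<in> B" using completion_ex by blast
    show ?thesis
      using completion_dist_eq[of A s B t] True st by (auto intro: LIMSEQ_le_const)
  qed (auto simp: completion_dist_def)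
  show "completion_dist A B = completion_dist B A" for A B
    by (auto simp: completion_dist_def commute)
  show "completion_dist A B = 0 \<longleftrightarrow> A = B" if AB: "A \<in> completion" "B \<in> completion" for A B
  proof -
    obtain s t where st: "s \<in> A" "t \<in> B" using completion_ex AB by blast
    have l: "(\<lambda>k. d (s k) (t k)) \<longlonglongrightarrow> completion_dist A B"
      using completion_dist_eq AB st by blast
    have "A = B \<longleftrightarrow> (s, t) \<in> null_rel"
      using completion_memD[OF AB(1) st(1)] completion_memD[OF AB(2) st(2)]
        eq_equiv_class_iff[OF equiv_null_rel, of s t] by auto
    also have "\<dots> \<longleftrightarrow> (\<lambda>k. d (s k) (t k)) \<longlonglongrightarrow> 0"
      using completion_memD(1)[OF AB(1) st(1)] completion_memD(1)[OF AB(2) st(2)]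
      by (simp add: null_rel_def)
    also have "\<dots> \<longleftrightarrow> completion_dist A B = 0" using l LIMSEQ_unique by metis
    finally show ?thesis by simp
  qed
  show "completion_dist A C \<le> completion_dist A B + completion_dist B C"
    if ABC: "A \<in> completion" "B \<in> completion" "C \<in> completion" for A B C
  proof -
    obtain s t u where stu: "s \<in> A" "t \<in> B" "u \<in> C" using completion_ex ABC by meson
    have l: "(\<lambda>k. d (s k) (t k) + d (t k) (u k)) \<longlonglongrightarrow> completion_dist A B + completion_dist B C"
      "(\<lambda>k. d (s k) (u k)) \<longlonglongrightarrow> completion_dist A C"
      using ABC stu by (auto intro!: tendsto_add completion_dist_eq)
    show ?thesis
      by (rule LIMSEQ_le[OF l(2,1)])
        (use completion_memD(1)[OF ABC(1) stu(1)] completion_memD(1)[OF ABC(2) stu(2)]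
            completion_memD(1)[OF ABC(3) stu(3)] in \<open>auto intro!: exI[of _ 0] triangle MCauchy_M\<close>)
  qed
qed

lemma MCauchy_const': "x \<in> M \<Longrightarrow> MCauchy (\<lambda>_. x)"
  by (auto simp: MCauchy_def)

lemma to_completion_mem: 
  assumes "x \<in> M"
  shows "to_completion x \<in> completion" "(\<lambda>_. x) \<in> to_completion x"
  using assms equiv_class_self[OF equiv_null_rel] MCauchy_const'
  unfolding to_completion_def completion_def by (auto intro!: quotientI)

lemma completion_dist_to_completion:
  assumes "x \<in> M" "y \<in> M"
  shows "completion_dist (to_completion x) (to_completion y) = d x y"
  using completion_dist_eq[OF to_completion_mem[OF assms(1)] to_completion_mem[OF assms(2)]]
  by (simp add: LIMSEQ_const_iff)

lemma to_completion_approx: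
  assumes "A \<in> completion" "s \<in> A" "e > 0"
  shows "\<exists>N. \<forall>k\<ge>N. completion_dist A (to_completion (s k)) < e"
proof -
  have C: "MCauchy s" using completion_memD(1) assms by blast
  obtain N where N: "\<And>m k. m \<ge> N \<Longrightarrow> k \<ge> N \<Longrightarrow> d (s m) (s k) < e/2"
    using C half_gt_zero[OF assms(3)] unfolding MCauchy_def by blast
  have "completion_dist A (to_completion (s k)) \<le> e/2" if "k \<ge> N" for k
  proof -
    have "(\<lambda>m. d (s m) (s k)) \<longlonglongrightarrow> completion_dist A (to_completion (s k))"
      using completion_dist_eq[OF assms(1,2) to_completion_mem[OF MCauchy_M[OF C]]] .
    then show ?thesis
      by (rule LIMSEQ_le_const2) (use N that in \<open>auto intro!: exI[of _ N] less_imp_le\<close>)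
  qed
  then show ?thesis using assms(3) by (intro exI[of _ N]) fastforce
qed

lemma mcomplete_completion: "Metric_space.mcomplete completion completion_dist"
proof -
  interpret C: Metric_space completion completion_dist by (rule Metric_space_completion)
  show ?thesis unfolding C.mcomplete_def
  proof (intro allI impI)
    fix \<sigma> assume \<sigma>: "C.MCauchy \<sigma>"
    have \<sigma>C: "\<sigma> k \<in> completion" for k using C.MCauchy_M[OF \<sigma>] .
    have "\<exists>x. x \<in> M \<and> completion_dist (\<sigma> k) (to_completion x) < 1 / Suc k" for k
    proof -
      obtain s where s: "s \<in> \<sigma> k" using completion_ex[OF \<sigma>C] by blast
      then show ?thesis
        using to_completion_approx[OF \<sigma>C s, of "1 / Suc k"] MCauchy_M[OF completion_memD(1)[OF \<sigma>C s]]
        by auto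
    qed
    then obtain x where x: "\<And>k. x k \<in> M"
      "\<And>k. completion_dist (\<sigma> k) (to_completion (x k)) < 1 / Suc k" by metis
    have small: "\<exists>N. \<forall>k\<ge>N. 1 / real (Suc k) < e" if "e > 0" for e
      using order_tendstoD(2)[OF LIMSEQ_inverse_real_of_nat that]
      by (simp add: eventually_sequentially inverse_eq_divide)
    have xC: "MCauchy x" unfolding MCauchy_def
    proof (intro conjI allI impI)
      show "range x \<subseteq> M" using x by auto
      fix e :: real assume "e > 0"
      then have e: "e/3 > 0" by simp
      obtain N1 where N1: "\<And>k. k \<ge> N1 \<Longrightarrow> 1 / real (Suc k) < e/3" using small[OF e] by blast
      obtain N2 where N2: "\<And>k m. k \<ge> N2 \<Longrightarrow> m \<ge> N2 \<Longrightarrow> completion_dist (\<sigma> k) (\<sigma> m) < e/3"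
        using \<sigma> e unfolding C.MCauchy_def by blast
      show "\<exists>N. \<forall>k m. N \<le> k \<longrightarrow> N \<le> m \<longrightarrow> d (x k) (x m) < e"
      proof (intro exI[of _ "max N1 N2"] allI impI)
        fix k m assume km: "max N1 N2 \<le> k" "max N1 N2 \<le> m"
        note [simp] = \<sigma>C to_completion_mem(1)[OF x(1)]
        have "d (x k) (x m) = completion_dist (to_completion (x k)) (to_completion (x m))"
          using completion_dist_to_completion x(1) by simp
        also have "\<dots> \<le> completion_dist (to_completion (x k)) (\<sigma> k) + completion_dist (\<sigma> k) (to_completion (x m))"
          by (rule C.triangle) auto
        also have "completion_dist (\<sigma> k) (to_completion (x m))
            \<le> completion_dist (\<sigma> k) (\<sigma> m) + completion_dist (\<sigma> m) (to_completion (x m))"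
          by (rule C.triangle) auto
        finally show "d (x k) (x m) < e"
          using N1[of k] N1[of m] N2[of k m] x(2)[of k] x(2)[of m] km
            C.commute[of "to_completion (x k)" "\<sigma> k"] by simp
      qed
    qed
    define L where "L = null_rel `` {x}"
    have L: "L \<in> completion" "x \<in> L"
      using xC equiv_class_self[OF equiv_null_rel] unfolding L_def completion_def
      by (auto intro!: quotientI)
    have "limitin C.mtopology \<sigma> L sequentially" unfolding C.limit_metric_sequentially
    proof (intro conjI allI impI)
      show "L \<in> completion" by (fact L)
      fix e :: real assume "e > 0"
      then have e: "e/2 > 0" by simp
      obtain N1 where N1: "\<And>k. k \<ge> N1 \<Longrightarrow> 1 / real (Suc k) < e/2" using small[OF e] by blast
      obtain N2 where N2: "\<And>k. k \<ge> N2 \<Longrightarrow> completion_dist L (to_completion (x k)) < e/2"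
        using to_completion_approx[OF L e] by blast
      show "\<exists>N. \<forall>k\<ge>N. \<sigma> k \<in> completion \<and> completion_dist (\<sigma> k) L < e"
      proof (intro exI[of _ "max N1 N2"] allI impI conjI \<sigma>C)
        fix k assume "max N1 N2 \<le> k"
        then show "completion_dist (\<sigma> k) L < e"
          using C.triangle[OF \<sigma>C[of k] to_completion_mem(1)[OF x(1)[of k]] L(1)] N1[of k] N2[of k]
            x(2)[of k] C.commute[of L "to_completion (x k)"] by simp
      qed
    qed
    then show "\<exists>x. limitin C.mtopology \<sigma> x sequentially" by blast
  qed
qed

end

definition padic_abs :: "nat \<Rightarrow> rat \<Rightarrow> real" where
  "padic_abs p q = (if q = 0 then 0 else
     (case quotient_of q of (a, b) \<Rightarrow>
        real p powi (int (multiplicity (int p) b) - int (multiplicity (int p) a))))"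

lemma padic_abs_frac:
  assumes p: "prime p" and ab: "a \<noteq> 0" "b \<noteq> 0"
  shows "padic_abs p (of_int a / of_int b) =
    real p powi (int (multiplicity (int p) b) - int (multiplicity (int p) a))"
proof -
  obtain c e where ce: "quotient_of (of_int a / of_int b) = (c, e)" by force
  have e: "e > 0" using quotient_of_denom_pos[OF ce] .
  have eq: "(of_int a / of_int b :: rat) = of_int c / of_int e" using quotient_of_div[OF ce] .
  have c: "c \<noteq> 0" using eq ab by auto
  have "(of_int (a * e) :: rat) = of_int (c * b)" using eq ab e by (simp add: field_simps)
  then have "a * e = c * b" by (simp only: of_int_eq_iff)
  then have "multiplicity (int p) (a * e) = multiplicity (int p) (c * b)" by simp
  then have "multiplicity (int p) a + multiplicity (int p) e
      = multiplicity (int p) c + multiplicity (int p) b"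
    using p ab c e by (simp add: prime_elem_multiplicity_mult_distrib)
  then have "int (multiplicity (int p) e) - int (multiplicity (int p) c)
     = int (multiplicity (int p) b) - int (multiplicity (int p) a)" by linarith
  then show ?thesis using ab by (simp add: padic_abs_def ce)
qed

lemma padic_abs_0 [simp]: "padic_abs p 0 = 0"
  by (simp add: padic_abs_def)

lemma padic_abs_pos: "prime p \<Longrightarrow> q \<noteq> 0 \<Longrightarrow> padic_abs p q > 0"
  by (auto simp: padic_abs_def prime_gt_0_nat split: prod.split)

lemma padic_abs_nonneg [simp]: "padic_abs p q \<ge> 0"
  by (auto simp: padic_abs_def split: prod.split)

lemma padic_abs_minus [simp]: "padic_abs p (- q) = padic_abs p q"
proof -
  obtain a b where ab: "quotient_of q = (a, b)" by force
  have "multiplicity (int p) (- a) = multiplicity (int p) a"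
    using multiplicity_times_unit_right[of "- 1" "int p" a] by simp
  then show ?thesis using ab by (simp add: padic_abs_def rat_uminus_code)
qed

lemma padic_abs_mult:
  assumes p: "prime p"
  shows "padic_abs p (q * r) = padic_abs p q * padic_abs p r"
proof (cases "q = 0 \<or> r = 0")
  case False
  obtain a b where q: "q = of_int a / of_int b" "b \<noteq> 0"
    by (metis quotient_of_div quotient_of_denom_pos less_irrefl surj_pair)
  obtain c e where r: "r = of_int c / of_int e" "e \<noteq> 0"
    by (metis quotient_of_div quotient_of_denom_pos less_irrefl surj_pair)
  have nz: "a \<noteq> 0" "c \<noteq> 0" using False q r by auto
  have qr: "q * r = of_int (a * c) / of_int (b * e)" using q r by simp
  have p0: "real p \<noteq> 0" using p by (auto dest: prime_gt_0_nat)
  show ?thesis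
    unfolding qr unfolding q(1) r(1) using p nz q(2) r(2) p0
    by (subst (1 2 3) padic_abs_frac)
      (auto simp: prime_elem_multiplicity_mult_distrib power_int_add[symmetric] algebra_simps)
qed auto

lemma padic_abs_ultrametric:
  assumes p: "prime p"
  shows "padic_abs p (q + r) \<le> max (padic_abs p q) (padic_abs p r)"
proof (cases "q = 0 \<or> r = 0 \<or> q + r = 0")
  case True
  then show ?thesis by (auto simp: le_max_iff_disj)
next
  case False
  obtain a b where q: "q = of_int a / of_int b" "b \<noteq> 0"
    by (metis quotient_of_div quotient_of_denom_pos less_irrefl surj_pair)
  obtain c e where r: "r = of_int c / of_int e" "e \<noteq> 0"
    by (metis quotient_of_div quotient_of_denom_pos less_irrefl surj_pair)
  define m a' c' where "m = b * e" and "a' = a * e" and "c' = c * b"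
  have m: "m \<noteq> 0" using q r by (simp add: m_def)
  have q': "q = of_int a' / of_int m" and r': "r = of_int c' / of_int m"
    using q r by (auto simp: a'_def c'_def m_def)
  have qr: "q + r = of_int (a' + c') / of_int m"
    using q' r' by (simp add: add_divide_distrib)
  have nz: "a' \<noteq> 0" "c' \<noteq> 0" "a' + c' \<noteq> 0" using False q' r' qr by auto
  let ?v = "multiplicity (int p)"
  have p1: "\<not> is_unit (int p)" using p by (metis not_prime_unit prime_nat_int_transfer)
  have "int p ^ min (?v a') (?v c') dvd a' + c'"
    by (intro dvd_add multiplicity_dvd') auto
  then have "min (?v a') (?v c') \<le> ?v (a' + c')"
    using nz p1 by (intro multiplicity_geI) auto
  then have "int (?v m) - int (?v (a' + c')) \<le> int (?v m) - int (?v a') \<or>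
      int (?v m) - int (?v (a' + c')) \<le> int (?v m) - int (?v c')"
    by linarith
  moreover have "real p \<ge> 1" using p by (simp add: Suc_leI prime_gt_0_nat)
  ultimately show ?thesis
    unfolding le_max_iff_disj
      qr[THEN arg_cong[where f = "padic_abs p"], unfolded padic_abs_frac[OF p nz(3) m]]
      q'[THEN arg_cong[where f = "padic_abs p"], unfolded padic_abs_frac[OF p nz(1) m]]
      r'[THEN arg_cong[where f = "padic_abs p"], unfolded padic_abs_frac[OF p nz(2) m]]
    by (blast intro: power_int_increasing)
qed

definition padic_rat_dist :: "nat \<Rightarrow> rat \<Rightarrow> rat \<Rightarrow> real" where
  "padic_rat_dist p q r = padic_abs p (q - r)"

lemma Metric_space_padic_rat:
  assumes "prime p"
  shows "Metric_space UNIV (padic_rat_dist p)"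
proof
  show "padic_rat_dist p x y = padic_rat_dist p y x" for x y
    using padic_abs_minus[of p "x - y"] by (simp add: padic_rat_dist_def del: padic_abs_minus)
  show "padic_rat_dist p x y = 0 \<longleftrightarrow> x = y" for x y
    using padic_abs_pos[OF assms, of "x - y"] by (cases "x = y") (auto simp: padic_rat_dist_def)
  show "padic_rat_dist p x z \<le> padic_rat_dist p x y + padic_rat_dist p y z" for x y z
    using padic_abs_ultrametric[OF assms, of "x - y" "y - z"]
      padic_abs_nonneg[of p "x - y"] padic_abs_nonneg[of p "y - z"]
    unfolding padic_rat_dist_def by (simp del: padic_abs_nonneg)
qed (simp add: padic_rat_dist_def)

text \<open>As a metric space, the field of \<open>p\<close>-adic numbers is the completion of the rationals. Its points
  are classes of \<open>p\<close>-adic Cauchy sequences modulo null sequences.\<close>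

definition Qp :: "nat \<Rightarrow> (nat \<Rightarrow> rat) set set" where
  "Qp p = Metric_space.completion UNIV (padic_rat_dist p)"

definition Qp_dist :: "nat \<Rightarrow> (nat \<Rightarrow> rat) set \<Rightarrow> (nat \<Rightarrow> rat) set \<Rightarrow> real" where
  "Qp_dist p = Metric_space.completion_dist UNIV (padic_rat_dist p)"

definition Qp_topology :: "nat \<Rightarrow> (nat \<Rightarrow> rat) set topology" where
  "Qp_topology p = Metric_space.mtopology (Qp p) (Qp_dist p)"

definition rat_to_Qp :: "nat \<Rightarrow> rat \<Rightarrow> (nat \<Rightarrow> rat) set" where
  "rat_to_Qp p = Metric_space.to_completion UNIV (padic_rat_dist p)"

lemma Qp_complete_metric:
  assumes "prime p"
  shows "Metric_space (Qp p) (Qp_dist p)" "Metric_space.mcomplete (Qp p) (Qp_dist p)"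
    "rat_to_Qp p q \<in> Qp p"
    "Qp_dist p (rat_to_Qp p q) (rat_to_Qp p r) = padic_abs p (q - r)"
proof -
  interpret Metric_space UNIV "padic_rat_dist p" by (rule Metric_space_padic_rat[OF assms])
  show "Metric_space (Qp p) (Qp_dist p)" "Metric_space.mcomplete (Qp p) (Qp_dist p)"
    "rat_to_Qp p q \<in> Qp p"
    unfolding Qp_def Qp_dist_def rat_to_Qp_def
    using Metric_space_completion mcomplete_completion to_completion_mem(1)[of q] by auto
  show "Qp_dist p (rat_to_Qp p q) (rat_to_Qp p r) = padic_abs p (q - r)"
    unfolding Qp_dist_def rat_to_Qp_def
    using completion_dist_to_completion[of q r] by (simp add: padic_rat_dist_def)
qed

lemma rat_dense_Qp:
  assumes "prime p" "A \<in> Qp p" "e > 0"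
  shows "\<exists>q. Qp_dist p A (rat_to_Qp p q) < e"
proof -
  interpret Metric_space UNIV "padic_rat_dist p" by (rule Metric_space_padic_rat[OF assms(1)])
  show ?thesis
    using completion_ex[of A] to_completion_approx[of A _ e] assms(2,3)
    unfolding Qp_def Qp_dist_def rat_to_Qp_def by blast
qed

definition Z_inv :: "nat \<Rightarrow> rat set" where
  "Z_inv p = {of_int a / of_nat p ^ k | a k. True}"

definition UT :: "nat \<Rightarrow> 'a::comm_ring_1 set \<Rightarrow> 'a mat set" where
  "UT n R = {A \<in> carrier_mat n n. upper_triangular A \<and>
     (\<forall>i<n. A $$ (i, i) = 1) \<and> (\<forall>i<n. \<forall>j<n. A $$ (i, j) \<in> R)}"

definition diag_pow :: "nat \<Rightarrow> nat \<Rightarrow> int Matrix.vec \<Rightarrow> rat mat" where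
  "diag_pow p n x = mat_diag n (\<lambda>i. of_nat p powi (x $ i))"

definition ZUT :: "nat \<Rightarrow> nat \<Rightarrow> (int Matrix.vec \<times> rat mat) monoid" where
  "ZUT p n =
    \<lparr>carrier = carrier_vec n \<times> UT n (Z_inv p),
     monoid.mult = (\<lambda>(x, f) (y, g). (x + y, f * (diag_pow p n x * g * diag_pow p n (- x)))),
     one = (0\<^sub>v n, 1\<^sub>m n)\<rparr>"

lemma diag_pow_inverse:
  assumes "p > 0" "x \<in> carrier_vec n"
  shows "diag_pow p n x * diag_pow p n (- x) = 1\<^sub>m n"
proof -
  have "diag_pow p n x * diag_pow p n (- x) = mat_diag n (\<lambda>i. of_nat p powi (x $ i) * of_nat p powi ((- x) $ i))"
    by (simp add: diag_pow_def)
  also have "\<dots> = 1\<^sub>m n"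
    using assms by (intro eq_matI) (auto simp: mat_diag_def power_int_minus)
  finally show ?thesis .
qed

lemma Z_inv_closed:
  assumes "p > 0"
  shows "0 \<in> Z_inv p" "1 \<in> Z_inv p"
    "q \<in> Z_inv p \<Longrightarrow> - q \<in> Z_inv p"
    "q \<in> Z_inv p \<Longrightarrow> r \<in> Z_inv p \<Longrightarrow> q + r \<in> Z_inv p"
    "q \<in> Z_inv p \<Longrightarrow> r \<in> Z_inv p \<Longrightarrow> q * r \<in> Z_inv p"
    "of_nat p powi z \<in> Z_inv p"
proof -
  have I: "of_int a / of_nat p ^ k \<in> Z_inv p" for a k unfolding Z_inv_def by blast
  show "0 \<in> Z_inv p" "1 \<in> Z_inv p" using I[of 0 0] I[of 1 0] by auto
  show "- q \<in> Z_inv p" if q: "q \<in> Z_inv p"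
  proof -
    obtain a k where "q = of_int a / of_nat p ^ k" using q unfolding Z_inv_def by blast
    then show ?thesis using I[of "- a" k] by simp
  qed
  show "q + r \<in> Z_inv p" "q * r \<in> Z_inv p" if qr: "q \<in> Z_inv p" "r \<in> Z_inv p"
  proof -
    obtain a k where q: "q = of_int a / of_nat p ^ k" using qr unfolding Z_inv_def by blast
    obtain b l where r: "r = of_int b / of_nat p ^ l" using qr unfolding Z_inv_def by blast
    have "q + r = of_int (a * int p ^ l + b * int p ^ k) / of_nat p ^ (k + l)"
      using assms by (simp add: q r field_simps power_add)
    then show "q + r \<in> Z_inv p" using I by metis
    have "q * r = of_int (a * b) / of_nat p ^ (k + l)"
      using assms by (simp add: q r power_add)
    then show "q * r \<in> Z_inv p" using I by metis
  qed
  show "of_nat p powi z \<in> Z_inv p"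
    using I[of "int p ^ nat z" 0] I[of 1 "nat (- z)"]
    by (simp add: power_int_def inverse_eq_divide power_one_over)
qed

lemma Z_inv_sum:
  assumes "p > 0" "\<And>k. k \<in> K \<Longrightarrow> h k \<in> Z_inv p"
  shows "sum h K \<in> Z_inv p"
  using assms(2) by (induction K rule: infinite_finite_induct) (auto intro: Z_inv_closed[OF assms(1)])

lemma UT_D:
  assumes "A \<in> UT n R"
  shows "A \<in> carrier_mat n n" "dim_row A = n" "dim_col A = n"
    "i < n \<Longrightarrow> j < i \<Longrightarrow> A $$ (i, j) = 0" "i < n \<Longrightarrow> A $$ (i, i) = 1"
    "i < n \<Longrightarrow> j < n \<Longrightarrow> A $$ (i, j) \<in> R"
  using assms by (auto simp: UT_def upper_triangular_def)

lemma UT_I: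
  assumes "A \<in> carrier_mat n n" "\<And>i j. i < n \<Longrightarrow> j < i \<Longrightarrow> A $$ (i, j) = 0"
    "\<And>i. i < n \<Longrightarrow> A $$ (i, i) = 1" "\<And>i j. i < n \<Longrightarrow> j < n \<Longrightarrow> A $$ (i, j) \<in> R"
  shows "A \<in> UT n R"
  using assms by (auto simp: UT_def upper_triangular_def)

lemma mat_times_index:
  assumes "A \<in> carrier_mat n n" "B \<in> carrier_mat n n" "i < n" "j < n"
  shows "(A * B) $$ (i, j) = (\<Sum>k<n. A $$ (i, k) * B $$ (k, j))"
  using assms by (auto simp: scalar_prod_def atLeast0LessThan intro!: sum.cong)

lemma UT_times_index:
  assumes A: "A \<in> UT n R" and B: "B \<in> UT n R" and ij: "i < n" "j < n"
  shows "(A * B) $$ (i, j) = (\<Sum>k\<in>{i..j}. A $$ (i, k) * B $$ (k, j))"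
  unfolding mat_times_index[OF UT_D(1)[OF A] UT_D(1)[OF B] ij]
  using ij UT_D(4)[OF A] UT_D(4)[OF B]
  by (intro sum.mono_neutral_right) (auto simp: not_le)

lemma UT_times:
  assumes p: "p > 0" and A: "A \<in> UT n (Z_inv p)" and B: "B \<in> UT n (Z_inv p)"
  shows "A * B \<in> UT n (Z_inv p)"
proof (rule UT_I)
  show "A * B \<in> carrier_mat n n" using UT_D(1)[OF A] UT_D(1)[OF B] by simp
next
  fix i j assume "i < n" "j < i"
  then show "(A * B) $$ (i, j) = 0" using UT_times_index[OF A B, of i j] by simp
next
  fix i assume "i < n"
  then show "(A * B) $$ (i, i) = 1"
    using UT_times_index[OF A B, of i i] UT_D(5)[OF A] UT_D(5)[OF B] by simp
next
  fix i j assume "i < n" "j < n"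
  then show "(A * B) $$ (i, j) \<in> Z_inv p"
    using UT_times_index[OF A B, of i j] UT_D(6)[OF A] UT_D(6)[OF B]
    by (auto intro!: Z_inv_sum[OF p] Z_inv_closed[OF p])
qed

lemma UT_one: "p > 0 \<Longrightarrow> 1\<^sub>m n \<in> UT n (Z_inv p)"
  by (rule UT_I) (auto intro: Z_inv_closed)

lemma UT_approx_inverse:
  assumes p: "p > 0" and A: "A \<in> UT n (Z_inv p)"
  shows "\<exists>B \<in> UT n (Z_inv p). \<forall>i j. i < j \<longrightarrow> j < n \<longrightarrow> j < i + k \<longrightarrow> (A * B) $$ (i, j) = 0"
proof (induction k)
  case 0
  then show ?case using UT_one[OF p] by auto
next
  case (Suc k)
  then obtain B where B: "B \<in> UT n (Z_inv p)"
    and z: "\<And>i j. i < j \<Longrightarrow> j < n \<Longrightarrow> j < i + k \<Longrightarrow> (A * B) $$ (i, j) = 0" by blast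
  define C where "C = A * B"
  define E where "E = Matrix.mat n n (\<lambda>(i, j). if i = j then 1 else - C $$ (i, j))"
  have C: "C \<in> UT n (Z_inv p)" unfolding C_def by (rule UT_times[OF p A B])
  have E: "E \<in> UT n (Z_inv p)"
    by (rule UT_I) (auto simp: E_def UT_D(4)[OF C] intro: Z_inv_closed[OF p] UT_D(6)[OF C])
  have "(A * (B * E)) $$ (i, j) = 0" if ij: "i < j" "j < n" "j < i + Suc k" for i j
  proof -
    have "A * (B * E) = C * E"
      unfolding C_def using UT_D(1)[OF A] UT_D(1)[OF B] UT_D(1)[OF E] by (simp add: assoc_mult_mat)
    then have "(A * (B * E)) $$ (i, j) = (\<Sum>l\<in>{i..j}. C $$ (i, l) * E $$ (l, j))"
      using UT_times_index[OF C E, of i j] ij by simp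
    also have "\<dots> = (\<Sum>l\<in>{i, j}. C $$ (i, l) * E $$ (l, j))"
      using ij z[of i] by (intro sum.mono_neutral_right) (auto simp: C_def)
    also have "\<dots> = 0"
      using ij UT_D(5)[OF C] by (simp add: E_def)
    finally show ?thesis .
  qed
  then show ?case using UT_times[OF p B E] by blast
qed

lemma UT_inverse:
  assumes p: "p > 0" and A: "A \<in> UT n (Z_inv p)"
  shows "\<exists>B \<in> UT n (Z_inv p). B * A = 1\<^sub>m n"
proof -
  obtain B where B: "B \<in> UT n (Z_inv p)"
    and z: "\<And>i j. i < j \<Longrightarrow> j < n \<Longrightarrow> j < i + n \<Longrightarrow> (A * B) $$ (i, j) = 0"
    using UT_approx_inverse[OF p A, of n] by blast
  have AB: "A * B \<in> UT n (Z_inv p)" by (rule UT_times[OF p A B])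
  have "A * B = 1\<^sub>m n"
  proof (rule eq_matI)
    fix i j assume "i < dim_row (1\<^sub>m n :: rat mat)" "j < dim_col (1\<^sub>m n :: rat mat)"
    then show "(A * B) $$ (i, j) = 1\<^sub>m n $$ (i, j)"
      using z[of i j] UT_D(4,5)[OF AB] by (cases i j rule: linorder_cases) auto
  qed (use UT_D[OF AB] in auto)
  then show ?thesis
    using mat_mult_left_right_inverse[OF UT_D(1)[OF A] UT_D(1)[OF B]] B by blast
qed

lemma diag_pow_carrier [simp]:
  "diag_pow p n x \<in> carrier_mat n n" "dim_row (diag_pow p n x) = n" "dim_col (diag_pow p n x) = n"
  by (auto simp: diag_pow_def mat_diag_def)

lemma diag_conj_index:
  assumes "f \<in> carrier_mat n n" "i < n" "j < n" "p > 0" "x \<in> carrier_vec n"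
  shows "(diag_pow p n x * f * diag_pow p n (- x)) $$ (i, j)
    = of_nat p powi (x $ i - x $ j) * f $$ (i, j)"
  using assms
  by (simp add: diag_pow_def mat_diag_mult_left[of _ n n] mat_diag_mult_right[of _ n n]
      power_int_diff power_int_minus field_simps)

lemma diag_conj_UT:
  assumes p: "p > 0" and f: "f \<in> UT n (Z_inv p)" and x: "x \<in> carrier_vec n"
  shows "diag_pow p n x * f * diag_pow p n (- x) \<in> UT n (Z_inv p)"
proof (rule UT_I)
  note D = UT_D[OF f]
  note I = diag_conj_index[OF D(1) _ _ p x]
  show "diag_pow p n x * f * diag_pow p n (- x) \<in> carrier_mat n n"
    using D(1) by (meson mult_carrier_mat diag_pow_carrier(1))
  show "(diag_pow p n x * f * diag_pow p n (- x)) $$ (i, j) = 0" if "i < n" "j < i" for i j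
    using that D(4)[of i j] by (subst I) auto
  show "(diag_pow p n x * f * diag_pow p n (- x)) $$ (i, i) = 1" if "i < n" for i
    using that D(5)[of i] by (subst I) auto
  show "(diag_pow p n x * f * diag_pow p n (- x)) $$ (i, j) \<in> Z_inv p" if "i < n" "j < n" for i j
    using that D(6)[of i j] by (subst I) (auto intro: Z_inv_closed[OF p])
qed

lemma diag_conj_times:
  assumes p: "p > 0" and f: "f \<in> carrier_mat n n" "g \<in> carrier_mat n n"
    and x: "x \<in> carrier_vec n"
  shows "diag_pow p n x * (f * g) * diag_pow p n (- x)
    = (diag_pow p n x * f * diag_pow p n (- x)) * (diag_pow p n x * g * diag_pow p n (- x))"
proof -
  have c: "diag_pow p n y \<in> carrier_mat n n" for y by simp
  show ?thesis
  proof (rule eq_matI)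
    fix i j assume "i < dim_row ((diag_pow p n x * f * diag_pow p n (- x)) * (diag_pow p n x * g * diag_pow p n (- x)))"
      "j < dim_col ((diag_pow p n x * f * diag_pow p n (- x)) * (diag_pow p n x * g * diag_pow p n (- x)))"
    then have ij: "i < n" "j < n" by auto
    have p0: "(of_nat p :: rat) \<noteq> 0" using p by simp
    have "of_nat p powi (x $ i - x $ j) * (\<Sum>k<n. f $$ (i, k) * g $$ (k, j)) =
      (\<Sum>k<n. of_nat p powi (x $ i - x $ k) * f $$ (i, k) * (of_nat p powi (x $ k - x $ j) * g $$ (k, j)))"
      using p0 by (auto simp: sum_distrib_left power_int_diff intro!: sum.cong)
    then show "(diag_pow p n x * (f * g) * diag_pow p n (- x)) $$ (i, j) =
        ((diag_pow p n x * f * diag_pow p n (- x)) * (diag_pow p n x * g * diag_pow p n (- x))) $$ (i, j)"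
      using ij p x f c
      by (subst mat_times_index[of _ n]) (auto simp: diag_conj_index mat_times_index simp del: index_mult_mat(1))
  qed auto
qed

lemma diag_conj_conj:
  assumes p: "p > 0" and f: "f \<in> carrier_mat n n"
    and x: "x \<in> carrier_vec n" "y \<in> carrier_vec n"
  shows "diag_pow p n x * (diag_pow p n y * f * diag_pow p n (- y)) * diag_pow p n (- x)
    = diag_pow p n (x + y) * f * diag_pow p n (- (x + y))"
proof (rule eq_matI)
  have c: "diag_pow p n y \<in> carrier_mat n n" for y by simp
  fix i j assume "i < dim_row (diag_pow p n (x + y) * f * diag_pow p n (- (x + y)))"
    "j < dim_col (diag_pow p n (x + y) * f * diag_pow p n (- (x + y)))"
  then have ij: "i < n" "j < n" by auto
  have p0: "(of_nat p :: rat) \<noteq> 0" using p by simp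
  have m: "diag_pow p n y * f * diag_pow p n (- y) \<in> carrier_mat n n" using c f by (meson mult_carrier_mat)
  show "(diag_pow p n x * (diag_pow p n y * f * diag_pow p n (- y)) * diag_pow p n (- x)) $$ (i, j) =
      (diag_pow p n (x + y) * f * diag_pow p n (- (x + y))) $$ (i, j)"
    unfolding diag_conj_index[OF m ij p x(1)] diag_conj_index[OF f ij p x(2)]
      diag_conj_index[OF f ij p add_carrier_vec[OF x]]
    using ij x p0 by (simp add: power_int_add[symmetric] algebra_simps flip: mult.assoc)
qed auto

lemma group_ZUT:
  assumes "prime p"
  shows "group (ZUT p n)"
proof -
  have p: "p > 0" using assms by (rule prime_gt_0_nat)
  let ?c = "\<lambda>x g. diag_pow p n x * g * diag_pow p n (- x)"
  show ?thesis
  proof (rule groupI)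
    fix a b assume "a \<in> carrier (ZUT p n)" "b \<in> carrier (ZUT p n)"
    then show "a \<otimes>\<^bsub>ZUT p n\<^esub> b \<in> carrier (ZUT p n)"
      by (auto simp: ZUT_def intro!: UT_times[OF p] diag_conj_UT[OF p])
  next
    show "\<one>\<^bsub>ZUT p n\<^esub> \<in> carrier (ZUT p n)" by (simp add: ZUT_def UT_one[OF p])
  next
    fix a b e assume "a \<in> carrier (ZUT p n)" "b \<in> carrier (ZUT p n)" "e \<in> carrier (ZUT p n)"
    moreover obtain x f y g z h where "a = (x, f)" "b = (y, g)" "e = (z, h)" by (metis surj_pair)
    ultimately have *: "a = (x, f)" "b = (y, g)" "e = (z, h)"
      and v: "x \<in> carrier_vec n" "y \<in> carrier_vec n" "z \<in> carrier_vec n"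
      and u: "f \<in> UT n (Z_inv p)" "g \<in> UT n (Z_inv p)" "h \<in> UT n (Z_inv p)"
      by (auto simp: ZUT_def)
    note U = UT_D(1)[OF u(1)] UT_D(1)[OF u(2)] UT_D(1)[OF u(3)]
    note C = UT_D(1)[OF diag_conj_UT[OF p]]
    have "f * ?c x (g * ?c y h) = f * (?c x g * ?c x (?c y h))"
      using diag_conj_times[OF p U(2) C[OF u(3) v(2)] v(1)] by simp
    also have "?c x (?c y h) = ?c (x + y) h" using diag_conj_conj[OF p U(3) v(1,2)] .
    also have "f * (?c x g * ?c (x + y) h) = (f * ?c x g) * ?c (x + y) h"
      using assoc_mult_mat[OF U(1) C[OF u(2) v(1)] C[OF u(3) add_carrier_vec[OF v(1,2)]]] by simp
    finally show "a \<otimes>\<^bsub>ZUT p n\<^esub> b \<otimes>\<^bsub>ZUT p n\<^esub> e = a \<otimes>\<^bsub>ZUT p n\<^esub> (b \<otimes>\<^bsub>ZUT p n\<^esub> e)"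
      using assoc_add_vec[OF v] by (simp add: * ZUT_def)
  next
    fix a assume "a \<in> carrier (ZUT p n)"
    moreover obtain x f where "a = (x, f)" by (metis surj_pair)
    ultimately have *: "a = (x, f)" and x: "x \<in> carrier_vec n" and u: "f \<in> UT n (Z_inv p)"
      by (auto simp: ZUT_def)
    note U = UT_D(1)[OF u]
    have "diag_pow p n (0\<^sub>v n) = 1\<^sub>m n" "diag_pow p n (- 0\<^sub>v n) = 1\<^sub>m n"
      by (auto simp: diag_pow_def mat_diag_def intro!: eq_matI)
    then show "\<one>\<^bsub>ZUT p n\<^esub> \<otimes>\<^bsub>ZUT p n\<^esub> a = a"
      using x U by (simp add: * ZUT_def)
    have x': "- x \<in> carrier_vec n" using x by simp
    obtain B where B: "B \<in> UT n (Z_inv p)" "B * ?c (- x) f = 1\<^sub>m n"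
      using UT_inverse[OF p diag_conj_UT[OF p u x']] by blast
    show "\<exists>b\<in>carrier (ZUT p n). b \<otimes>\<^bsub>ZUT p n\<^esub> a = \<one>\<^bsub>ZUT p n\<^esub>"
      using B x x' by (intro bexI[of _ "(- x, B)"]) (auto simp: ZUT_def *)
  qed
qed

text \<open>The length of a shortest word in \<open>S\<close> and its inverses that represents \<open>g\<close>; if there is no
  such word, the value is unspecified.\<close>

definition word_length :: "('a, 'b) monoid_scheme \<Rightarrow> 'a set \<Rightarrow> 'a \<Rightarrow> nat" where
  "word_length G S g = (LEAST m. \<exists>ws. length ws = m \<and> set ws \<subseteq> S \<union> m_inv G ` S \<and>
     foldr (monoid.mult G) ws (one G) = g)"

text \<open>Coordinates of \<open>\<int>\<^sup>n\<close> and matrix entries are numbered from 0 to \<open>n - 1\<close>.\<close>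

definition coord_law :: "(int Matrix.vec \<times> rat mat) pmf \<Rightarrow> nat \<Rightarrow> int pmf" where
  "coord_law \<mu> i = map_pmf (\<lambda>(x, f). x $ i) \<mu>"

definition first_moment :: "int pmf \<Rightarrow> real" where
  "first_moment \<nu> = measure_pmf.expectation \<nu> real_of_int"

definition displacement :: "nat \<Rightarrow> (int Matrix.vec \<times> rat mat) pmf \<Rightarrow> real mat" where
  "displacement n \<mu> =
     Matrix.mat n n (\<lambda>(i, j). first_moment (coord_law \<mu> i) - first_moment (coord_law \<mu> j))"

text \<open>The steps are \<open>z 1\<close>, \<open>z 2\<close>, and so on; \<open>z 0\<close> is not used.\<close>

primrec right_walk :: "('a, 'b) monoid_scheme \<Rightarrow> (nat \<Rightarrow> 'a) \<Rightarrow> nat \<Rightarrow> 'a" where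
  "right_walk G z 0 = \<one>\<^bsub>G\<^esub>"
| "right_walk G z (Suc m) = right_walk G z m \<otimes>\<^bsub>G\<^esub> z (Suc m)"

end

theory Submission
  imports Defs
begin

text \<open>The increments of the walk are
  \<open>\<phi>\<^sub>i\<^sub>j(m + 1) - \<phi>\<^sub>i\<^sub>j(m) = (\<Sum>i \<le> k < j. \<phi>\<^sub>i\<^sub>k(m) p\<^bsup>y\<^sub>k(m) - y\<^sub>j(m)\<^esup> f\<^sub>k\<^sub>j(m + 1))\<close>.
  By the strong law of large numbers \<open>y\<^sub>k(m) = d\<^sub>k m + o(m)\<close>, and the word length of the \<open>m\<close>-th step,
  which bounds the logarithms of the \<open>p\<close>-adic norms of its entries up to a constant factor, is \<open>o(m)\<close>.
  If \<open>c\<close> is the minimum of \<open>d\<^sub>k\<close> over \<open>i \<le> k < j\<close>, induction on \<open>k\<close> gives that \<open>\<phi>\<^sub>i\<^sub>k(m)\<close> has norm at most \<open>p\<close>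
  to the power \<open>(d\<^sub>k - c) m + o(m)\<close>. Hence the increments of \<open>\<phi>\<^sub>i\<^sub>j\<close> have norm at most \<open>p\<close> to the power
  \<open>(d\<^sub>j - c) m + o(m)\<close>. The sign condition says \<open>d\<^sub>j < c\<close>, so the entry is a \<open>p\<close>-adic Cauchy sequence.\<close>

section \<open>The strong law of large numbers\<close>

text \<open>Serves to shift indices by one: in the stationarity argument below, and for the steps of
  the walk, which are numbered from 1.\<close>

lemma (in prob_space) indep_vars_reindex_inj:
  assumes "indep_vars M' X (f ` I)" "inj_on f I"
  shows "indep_vars (\<lambda>i. M' (f i)) (\<lambda>i. X (f i)) I"
  unfolding indep_vars_def
proof (intro conjI ballI indep_setsI)
  let ?F = "\<lambda>i. sigma_sets (space M) {X i -` A \<inter> space M |A. A \<in> sets (M' i)}"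
  have ind: "indep_sets ?F (f ` I)"
    using assms(1) by (simp add: indep_vars_def)
  show "X (f i) \<in> measurable M (M' (f i))" if "i \<in> I" for i
    using assms(1) that by (simp add: indep_vars_def)
  show "?F (f i) \<subseteq> events" if "i \<in> I" for i
    using ind that unfolding indep_sets_def by blast
  fix A J assume J: "J \<noteq> {}" "J \<subseteq> I" "finite J" and A: "\<forall>j\<in>J. A j \<in> ?F (f j)"
  have inj: "inj_on f J" using assms(2) J(2) by (rule inj_on_subset)
  have "prob (\<Inter>j\<in>f ` J. A (the_inv_into J f j)) = (\<Prod>j\<in>f ` J. prob (A (the_inv_into J f j)))"
    using J A by (intro indep_setsD[OF ind]) (auto simp: the_inv_into_f_f[OF inj])
  then show "prob (\<Inter>j\<in>J. A j) = (\<Prod>j\<in>J. prob (A j))"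
    by (simp add: prod.reindex[OF inj] the_inv_into_f_f[OF inj])
qed

section \<open>Maximal partial sums\<close>

text \<open>This is the maximum of the sums \<open>\<Sum>k<m. y k\<close> over
  \<open>m \<le> n\<close>, the empty sum included. Peeling off the first term ties it to the
  maximum for the shifted sequence, which is the relation that the maximal argument
  exploits.\<close>

primrec max_partial_sum :: "nat \<Rightarrow> (nat \<Rightarrow> real) \<Rightarrow> real" where
  "max_partial_sum 0 y = 0"
| "max_partial_sum (Suc n) y = max 0 (y 0 + max_partial_sum n (\<lambda>k. y (Suc k)))"

lemma max_partial_sum_nonneg: "max_partial_sum n y \<ge> 0"
  by (cases n) auto

lemma max_partial_sum_mono: "max_partial_sum n y \<le> max_partial_sum (Suc n) y"
proof (induction n arbitrary: y)
  case (Suc n)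
  show ?case
    unfolding max_partial_sum.simps(2)[of n y] max_partial_sum.simps(2)[of "Suc n" y]
    by (intro max.mono add_left_mono order_refl Suc)
qed simp

lemma sum_le_max_partial_sum: "m \<le> n \<Longrightarrow> (\<Sum>k<m. y k) \<le> max_partial_sum n y"
proof (induction n arbitrary: m y)
  case (Suc n)
  show ?case
  proof (cases m)
    case (Suc m')
    then show ?thesis
      using Suc.IH[of m' "\<lambda>k. y (Suc k)"] Suc.prems
      by (simp add: sum.lessThan_Suc_shift del: sum.lessThan_Suc)
  qed (simp add: max_partial_sum_nonneg)
qed auto

text \<open>Provides the integrable bound under which the maxima have finite mean.\<close>

lemma max_partial_sum_le: "max_partial_sum n y \<le> (\<Sum>k<n. \<bar>y k\<bar>)"
proof (induction n arbitrary: y)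
  case (Suc n)
  have "max_partial_sum n (\<lambda>k. y (Suc k)) \<le> (\<Sum>k<n. \<bar>y (Suc k)\<bar>)" by (rule Suc.IH)
  moreover have "(\<Sum>k<n. \<bar>y (Suc k)\<bar>) \<ge> 0" by (intro sum_nonneg) auto
  ultimately show ?case
    by (simp add: sum.lessThan_Suc_shift del: sum.lessThan_Suc)
qed auto

lemma measurable_max_partial_sum [measurable]:
  "max_partial_sum n \<in> borel_measurable (\<Pi>\<^sub>M i\<in>UNIV. borel)"
proof (induction n)
  case (Suc n)
  have "(\<lambda>y k. y (Suc k)) \<in> measurable (\<Pi>\<^sub>M i\<in>UNIV. borel) (\<Pi>\<^sub>M i\<in>UNIV. borel)"
    by (rule measurable_PiM_single') (auto simp: space_PiM)
  from measurable_compose[OF this Suc] show ?case by simp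
qed simp

section \<open>Boundedness of partial sums: the 0-1 law and the maximal argument\<close>

text \<open>Dropping the first \<open>n\<close> terms changes the later sums by one constant and
  loses only finitely many sums. Boundedness is therefore a tail property.\<close>

lemma bdd_above_range_partial_sums:
  fixes y :: "nat \<Rightarrow> real"
  shows "bdd_above (range (\<lambda>m. \<Sum>k<m. y (k + n))) \<longleftrightarrow> bdd_above (range (\<lambda>m. \<Sum>k<m. y k))"
proof -
  have eq: "(\<Sum>k<m + n. y k) = (\<Sum>k<m. y (k + n)) + (\<Sum>k<n. y k)" for m
    using sum.shift_bounds_nat_ivl[of y 0 n m]
    by (subst atLeast0LessThan[symmetric], subst sum.atLeastLessThan_concat[of 0 n "m + n" y, symmetric])
      (auto simp: atLeast0LessThan)
  show ?thesis
  proof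
    assume "bdd_above (range (\<lambda>m. \<Sum>k<m. y (k + n)))"
    then obtain B where B: "\<And>m. (\<Sum>k<m. y (k + n)) \<le> B" by (auto simp: bdd_above_def)
    have "(\<Sum>k<m. y k) \<le> max (B + (\<Sum>k<n. y k)) (Max ((\<lambda>m. \<Sum>k<m. y k) ` {..n}))" for m
    proof (cases "m \<le> n")
      case False
      then show ?thesis using eq[of "m - n"] B[of "m - n"] by (simp add: le_max_iff_disj)
    qed (auto simp: le_max_iff_disj intro!: Max_ge)
    then show "bdd_above (range (\<lambda>m. \<Sum>k<m. y k))" by (auto simp: bdd_above_def)
  next
    assume "bdd_above (range (\<lambda>m. \<Sum>k<m. y k))"
    then obtain B where "\<And>m. (\<Sum>k<m. y k) \<le> B" by (auto simp: bdd_above_def)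
    then have "(\<Sum>k<m. y (k + n)) \<le> B - (\<Sum>k<n. y k)" for m using eq[of m] by (metis le_diff_eq)
    then show "bdd_above (range (\<lambda>m. \<Sum>k<m. y (k + n)))" by (auto simp: bdd_above_def)
  qed
qed

text \<open>With natural bounds the quantifier is countable, so that boundedness is seen to be a
  measurable event.\<close>

lemma bdd_above_range_iff_nat:
  fixes f :: "'b \<Rightarrow> real"
  shows "bdd_above (range f) \<longleftrightarrow> (\<exists>b::nat. \<forall>m. f m \<le> real b)"
proof
  assume "bdd_above (range f)"
  then obtain B where B: "\<And>m. f m \<le> B" by (auto simp: bdd_above_def)
  obtain b :: nat where "B \<le> real b" using real_arch_simple by blast
  then show "\<exists>b::nat. \<forall>m. f m \<le> real b" using B order_trans by blast
qed (auto simp: bdd_above_def)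

lemma (in prob_space) bdd_above_partial_sums_0_1:
  fixes Y :: "nat \<Rightarrow> 'a \<Rightarrow> real"
  assumes indep: "indep_vars (\<lambda>_. borel) Y UNIV"
  defines "B \<equiv> {\<omega> \<in> space M. bdd_above (range (\<lambda>m. \<Sum>k<m. Y k \<omega>))}"
  shows "B \<in> events" "prob B = 0 \<or> prob B = 1"
proof -
  define A where "A = (\<lambda>i. sigma_sets (space M) {Y i -` S \<inter> space M |S. S \<in> sets borel})"
  have ind: "indep_sets A UNIV"
    using indep by (simp add: indep_vars_def A_def)
  have "B \<in> sigma_sets (space M) (\<Union>i\<in>{n..}. A i)" for n
  proof -
    \<comment> \<open>\<open>N\<close> carries the sigma-algebra generated by the variables from
      index \<open>n\<close> on. Membership of \<open>B\<close> in it for every \<open>n\<close>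
      makes \<open>B\<close> a tail event.\<close>
    define N where "N = sigma (space M) (\<Union>i\<in>{n..}. A i)"
    have AM: "(\<Union>i\<in>{n..}. A i) \<subseteq> Pow (space M)"
      by (auto simp: A_def dest: sigma_sets_into_sp[rotated])
    have [simp]: "space N = space M" and sN: "sets N = sigma_sets (space M) (\<Union>i\<in>{n..}. A i)"
      using AM by (simp_all add: N_def)
    have [measurable]: "(\<lambda>\<omega>. Y (k + n) \<omega>) \<in> borel_measurable N" for k
    proof (rule measurableI)
      fix S :: "real set" assume "S \<in> sets borel"
      then have "Y (k + n) -` S \<inter> space M \<in> A (k + n)" unfolding A_def by blast
      then show "Y (k + n) -` S \<inter> space N \<in> sets N"
        unfolding sN by (auto intro!: sigma_sets.Basic bexI[of _ "k + n"])
    qed auto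
    have "B = {\<omega> \<in> space N. \<exists>b::nat. \<forall>m. (\<Sum>k<m. Y (k + n) \<omega>) \<le> real b}"
      unfolding B_def bdd_above_range_partial_sums[of "\<lambda>k. Y k _" n, symmetric]
      by (simp add: bdd_above_range_iff_nat)
    also have "\<dots> \<in> sets N" by measurable
    finally show ?thesis by (simp add: sN)
  qed
  then have T: "B \<in> tail_events A" by (simp add: tail_events_def)
  have "A i \<subseteq> events" for i using ind unfolding indep_sets_def by blast
  then show "B \<in> events" using T tail_events_sets by blast
  show "prob B = 0 \<or> prob B = 1"
    by (rule kolmogorov_0_1_law[OF _ ind T])
      (auto simp: A_def intro!: sigma_algebra_sigma_sets)
qed

text \<open>Garsia's maximal argument: with \<open>F\<^sub>n\<close> the maximal partial sum and \<open>F'\<^sub>n\<close> that of the shifted sequence,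
  \<open>F\<^sub>n\<^sub>+\<^sub>1 - F'\<^sub>n = max (- F'\<^sub>n) Y\<^sub>0\<close> has nonnegative mean by stationarity. If \<open>F'\<^sub>n\<close> tended to infinity
  almost surely, dominated convergence would make the mean of \<open>Y\<^sub>0\<close> nonnegative; the 0-1 law leaves
  only the other case.\<close>

lemma (in prob_space) iid_negative_mean_bdd_above:
  fixes Y :: "nat \<Rightarrow> 'a \<Rightarrow> real"
  assumes indep: "indep_vars (\<lambda>_. borel) Y UNIV"
    and distr: "\<And>k. distr M borel (Y k) = distr M borel (Y 0)"
    and int: "integrable M (Y 0)" and neg: "expectation (Y 0) < 0"
  shows "AE \<omega> in M. bdd_above (range (\<lambda>m. \<Sum>k<m. Y k \<omega>))"
proof -
  define B where "B = {\<omega> \<in> space M. bdd_above (range (\<lambda>m. \<Sum>k<m. Y k \<omega>))}"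
  have Bm: "B \<in> events" and B01: "prob B = 0 \<or> prob B = 1"
    unfolding B_def using bdd_above_partial_sums_0_1[OF indep] by auto
  have [measurable]: "random_variable borel (Y k)" for k
    using indep by (simp add: indep_vars_def)
  have intY: "integrable M (Y k)" for k
  proof -
    have "integrable (distr M borel (Y 0)) (\<lambda>x. x)"
      using int by (subst integrable_distr_eq) auto
    then have "integrable (distr M borel (Y k)) (\<lambda>x. x)" by (simp only: distr[of k])
    then show ?thesis by (subst (asm) integrable_distr_eq) auto
  qed
  define P where "P = (\<Pi>\<^sub>M i\<in>(UNIV :: nat set). (borel :: real measure))"
  have Ym [measurable]: "(\<lambda>\<omega> k. Y k \<omega>) \<in> measurable M P" "(\<lambda>\<omega> k. Y (Suc k) \<omega>) \<in> measurable M P"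
    unfolding P_def by (rule measurable_PiM_single'; auto simp: space_PiM)+
  have Fm [measurable]: "max_partial_sum n \<in> borel_measurable P" for n
    unfolding P_def by (rule measurable_max_partial_sum)
  have indep': "indep_vars (\<lambda>_. borel) (\<lambda>k. Y (Suc k)) UNIV"
    by (rule indep_vars_reindex_inj) (auto intro: indep_vars_subset[OF indep])
  \<comment> \<open>By independence each joint law is the product of its marginals, and these agree;
    the shifted sequence thus has the law of the original one.\<close>
  have "distr M P (\<lambda>\<omega> k. Y (Suc k) \<omega>) = (\<Pi>\<^sub>M k\<in>UNIV. distr M borel (Y (Suc k)))"
    using indep' by (subst (asm) indep_vars_iff_distr_eq_PiM) (auto simp: P_def restrict_UNIV)
  also have "\<dots> = (\<Pi>\<^sub>M k\<in>UNIV. distr M borel (Y k))"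
    using distr by (metis (no_types, lifting))
  also have "\<dots> = distr M P (\<lambda>\<omega> k. Y k \<omega>)"
    using indep by (subst (asm) indep_vars_iff_distr_eq_PiM) (auto simp: P_def restrict_UNIV)
  finally have shift: "distr M P (\<lambda>\<omega> k. Y (Suc k) \<omega>) = distr M P (\<lambda>\<omega> k. Y k \<omega>)" .
  define F where "F = (\<lambda>n \<omega>. max_partial_sum n (\<lambda>k. Y k \<omega>))"
  define F' where "F' = (\<lambda>n \<omega>. max_partial_sum n (\<lambda>k. Y (Suc k) \<omega>))"
  have [measurable]: "F n \<in> borel_measurable M" "F' n \<in> borel_measurable M" for n
    unfolding F_def F'_def by measurable
  have intF: "integrable M (F n)" for n
    by (rule Bochner_Integration.integrable_bound[where f = "\<lambda>\<omega>. \<Sum>k<n. \<bar>Y k \<omega>\<bar>"])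
      (auto simp: F_def max_partial_sum_nonneg sum_nonneg intY intro!: max_partial_sum_le)
  have intF': "integrable M (F' n)" for n
    by (rule Bochner_Integration.integrable_bound[where f = "\<lambda>\<omega>. \<Sum>k<n. \<bar>Y (Suc k) \<omega>\<bar>"])
      (auto simp: F'_def max_partial_sum_nonneg sum_nonneg intY intro!: max_partial_sum_le)
  have EF: "expectation (F' n) = expectation (F n)" for n
    unfolding F_def F'_def
    using integral_distr[OF Ym(1) Fm[of n]] integral_distr[OF Ym(2) Fm[of n]] shift by simp
  define G where "G = (\<lambda>n \<omega>. max (- F' n \<omega>) (Y 0 \<omega>))"
  have [measurable]: "G n \<in> borel_measurable M" for n unfolding G_def by measurable
  have G: "G n = (\<lambda>\<omega>. F (Suc n) \<omega> - F' n \<omega>)" for n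
    by (auto simp: G_def F_def F'_def fun_eq_iff max_def)
  have EG: "expectation (G n) \<ge> 0" for n
  proof -
    \<comment> \<open>Since \<open>F' n\<close> and \<open>F n\<close> have equal means, the mean of
      \<open>G n\<close> is that of \<open>F (Suc n)\<close> minus that of
      \<open>F n\<close>.\<close>
    have "expectation (F n) \<le> expectation (F (Suc n))"
      by (intro integral_mono intF) (auto simp: F_def max_partial_sum_mono simp del: max_partial_sum.simps)
    then show ?thesis
      unfolding G Bochner_Integration.integral_diff[OF intF[of "Suc n"] intF'[of n]] EF by simp
  qed
  have "prob B \<noteq> 0"
  proof
    assume "prob B = 0"
    then have "B \<in> null_sets M" using Bm by (auto simp: emeasure_eq_measure)
    then have "AE \<omega> in M. \<omega> \<notin> B" by (rule AE_not_in)
    with AE_space have lim: "AE \<omega> in M. (\<lambda>n. G n \<omega>) \<longlonglongrightarrow> Y 0 \<omega>"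
    proof eventually_elim
      case (elim \<omega>)
      then have "\<not> bdd_above (range (\<lambda>m. \<Sum>k<m. Y (k + 1) \<omega>))"
        using bdd_above_range_partial_sums[of "\<lambda>k. Y k \<omega>" 1] by (simp add: B_def)
      then have "\<exists>m. \<not> (\<Sum>k<m. Y (k + 1) \<omega>) \<le> - Y 0 \<omega>"
        by (auto simp: bdd_above_def)
      then obtain m where "\<not> (\<Sum>k<m. Y (k + 1) \<omega>) \<le> - Y 0 \<omega>" by blast
      then have m: "(\<Sum>k<m. Y (Suc k) \<omega>) \<ge> - Y 0 \<omega>" by simp
      \<comment> \<open>Once a shifted partial sum reaches \<open>- Y 0 \<omega>\<close>, so do all
        later maxima, and the truncation in \<open>G\<close> has no effect any more.\<close>
      have "G n \<omega> = Y 0 \<omega>" if "n \<ge> m" for n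
        using sum_le_max_partial_sum[OF that, of "\<lambda>k. Y (Suc k) \<omega>"] m
        by (simp add: G_def F'_def)
      then show ?case by (intro tendsto_eventually) (auto simp: eventually_sequentially)
    qed
    \<comment> \<open>As \<open>F' n\<close> is nonnegative, \<open>G n\<close> equals
      \<open>Y 0\<close> where that is nonnegative and lies between \<open>Y 0\<close> and 0
      elsewhere.\<close>
    have "\<bar>G n \<omega>\<bar> \<le> \<bar>Y 0 \<omega>\<bar>" for n \<omega>
      using max_partial_sum_nonneg[of n "\<lambda>k. Y (Suc k) \<omega>"] by (auto simp: G_def F'_def)
    then have "(\<lambda>n. expectation (G n)) \<longlonglongrightarrow> expectation (Y 0)"
      using lim int by (intro integral_dominated_convergence[where w = "\<lambda>\<omega>. \<bar>Y 0 \<omega>\<bar>"]) auto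
    then have "expectation (Y 0) \<ge> 0" using EG by (auto intro: LIMSEQ_le_const)
    then show False using neg by simp
  qed
  then have "prob B = 1" using B01 by simp
  then have "AE \<omega> in M. \<omega> \<in> B" using Bm by (simp add: AE_in_set_eq_1)
  then show ?thesis by eventually_elim (simp add: B_def)
qed

section \<open>From one-sided bounds to the strong law\<close>

text \<open>Subtracting \<open>a\<close> from each term makes the mean negative, so the preceding
  result applies.\<close>

lemma (in prob_space) iid_partial_sums_upper:
  fixes Y :: "nat \<Rightarrow> 'a \<Rightarrow> real"
  assumes indep: "indep_vars (\<lambda>_. borel) Y UNIV"
    and distr: "\<And>k. distr M borel (Y k) = distr M borel (Y 0)"
    and int: "integrable M (Y 0)" and less: "expectation (Y 0) < a"
  shows "AE \<omega> in M. \<exists>C. \<forall>m. (\<Sum>k<m. Y k \<omega>) \<le> C + a * real m"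
proof -
  have [measurable]: "random_variable borel (Y k)" for k
    using indep by (simp add: indep_vars_def)
  have "AE \<omega> in M. bdd_above (range (\<lambda>m. \<Sum>k<m. Y k \<omega> - a))"
  proof (rule iid_negative_mean_bdd_above)
    show "indep_vars (\<lambda>_. borel) (\<lambda>k \<omega>. Y k \<omega> - a) UNIV"
      by (rule indep_vars_compose2[OF indep]) auto
    have "distr M borel (\<lambda>\<omega>. Y k \<omega> - a) = distr (distr M borel (Y k)) borel (\<lambda>x. x - a)" for k
      by (simp add: distr_distr comp_def)
    then show "distr M borel (\<lambda>\<omega>. Y k \<omega> - a) = distr M borel (\<lambda>\<omega>. Y 0 \<omega> - a)" for k
      using distr by metis
  qed (use int less in \<open>auto simp: prob_space\<close>)
  then show ?thesis
  proof eventually_elim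
    case (elim \<omega>)
    then obtain C where "\<And>m. (\<Sum>k<m. Y k \<omega> - a) \<le> C" by (auto simp: bdd_above_def)
    then show ?case by (intro exI[of _ C]) (auto simp: sum_subtractf algebra_simps)
  qed
qed

text \<open>The upper bound for \<open>Y\<close> and for \<open>- Y\<close> gives both directions.
  The random constant \<open>C\<close> makes the estimate valid for every \<open>m\<close>, not just
  eventually, as the later inductions on \<open>m\<close> want it.\<close>

lemma (in prob_space) iid_partial_sums_linear:
  fixes Y :: "nat \<Rightarrow> 'a \<Rightarrow> real"
  assumes indep: "indep_vars (\<lambda>_. borel) Y UNIV"
    and distr: "\<And>k. distr M borel (Y k) = distr M borel (Y 0)"
    and int: "integrable M (Y 0)"
  shows "AE \<omega> in M. \<forall>e>0. \<exists>C. \<forall>m. \<bar>(\<Sum>k<m. Y k \<omega>) - expectation (Y 0) * real m\<bar> \<le> C + e * real m"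
proof -
  have [measurable]: "random_variable borel (Y k)" for k
    using indep by (simp add: indep_vars_def)
  \<comment> \<open>Countably many tolerances suffice, so the exceptional null sets can be united
    before \<open>e\<close> is chosen.\<close>
  let ?u = "\<lambda>t. inverse (real (Suc t))"
  have "AE \<omega> in M. \<forall>t. \<exists>C. \<forall>m. (\<Sum>k<m. Y k \<omega>) \<le> C + (expectation (Y 0) + ?u t) * real m"
    by (simp only: AE_all_countable, intro allI iid_partial_sums_upper[OF indep distr int]) auto
  moreover have "AE \<omega> in M. \<forall>t. \<exists>C. \<forall>m. (\<Sum>k<m. - Y k \<omega>) \<le> C + (- expectation (Y 0) + ?u t) * real m"
  proof (simp only: AE_all_countable, intro allI iid_partial_sums_upper)
    show "indep_vars (\<lambda>_. borel) (\<lambda>k \<omega>. - Y k \<omega>) UNIV"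
      by (rule indep_vars_compose2[OF indep]) auto
    have "distr M borel (\<lambda>\<omega>. - Y k \<omega>) = distr (distr M borel (Y k)) borel uminus" for k
      by (simp add: distr_distr comp_def)
    then show "distr M borel (\<lambda>\<omega>. - Y k \<omega>) = distr M borel (\<lambda>\<omega>. - Y 0 \<omega>)" for k
      using distr by metis
  qed (use int in auto)
  ultimately show ?thesis
  proof eventually_elim
    case (elim \<omega>)
    show ?case
    proof (intro allI impI)
      fix e :: real assume "e > 0"
      then obtain t where t: "?u t < e" using reals_Archimedean by blast
      obtain C1 where C1: "\<And>m. (\<Sum>k<m. Y k \<omega>) \<le> C1 + (expectation (Y 0) + ?u t) * real m"
        using elim(1) by blast
      obtain C2 where C2: "\<And>m. (\<Sum>k<m. - Y k \<omega>) \<le> C2 + (- expectation (Y 0) + ?u t) * real m"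
        using elim(2) by blast
      have "\<bar>(\<Sum>k<m. Y k \<omega>) - expectation (Y 0) * real m\<bar> \<le> max C1 C2 + e * real m" for m
      proof -
        have "?u t * real m \<le> e * real m" using t by (intro mult_right_mono) auto
        then show ?thesis using C1[of m] C2[of m] by (auto simp: sum_negf algebra_simps)
      qed
      then show "\<exists>C. \<forall>m. \<bar>(\<Sum>k<m. Y k \<omega>) - expectation (Y 0) * real m\<bar> \<le> C + e * real m" by blast
    qed
  qed
qed

section \<open>Entries of a walk with linear drift\<close>

text \<open>The form with \<open>powr\<close> allows comparison with bounds whose exponents contain
  real drifts and tolerances.\<close>

lemma padic_abs_p_powi:
  assumes "prime p"
  shows "padic_abs p (of_nat p powi z) = real p powr - real_of_int z"
proof -
  have p: "p > 1" using assms by (rule prime_gt_1_nat)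
  then have p': "int p \<noteq> 0" "\<not> is_unit (int p)" by auto
  \<comment> \<open>At least one of the exponents \<open>nat z\<close> and \<open>nat (- z)\<close>
    is 0, so both signs of \<open>z\<close> are covered at once.\<close>
  have "(of_nat p powi z :: rat) = of_int (int p ^ nat z) / of_int (int p ^ nat (- z))"
    by (simp add: power_int_def inverse_eq_divide power_one_over)
  then have "padic_abs p (of_nat p powi z) = real p powi (int (nat (- z)) - int (nat z))"
    using padic_abs_frac[OF assms, of "int p ^ nat z" "int p ^ nat (- z)"] p p'
    by (simp add: multiplicity_same_power)
  also have "int (nat (- z)) - int (nat z) = - z" by simp
  also have "real p powi - z = real p powr - real_of_int z"
    using p powr_real_of_int'[of "real p" "- z"] by simp
  finally show ?thesis .
qed

lemma padic_abs_1: "prime p \<Longrightarrow> padic_abs p 1 = 1"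
  using padic_abs_p_powi[of p 0] by (simp add: prime_gt_0_nat)

lemma padic_abs_sum_le:
  assumes "prime p" "0 \<le> B" "\<And>k. k \<in> K \<Longrightarrow> padic_abs p (h k) \<le> B"
  shows "padic_abs p (sum h K) \<le> B"
  using assms(3)
proof (induction K rule: infinite_finite_induct)
  case (insert k K)
  then show ?case
    by (simp add: order_trans[OF padic_abs_ultrametric[OF assms(1)]])
qed (use assms(2) in auto)

text \<open>By the ultrametric inequality a telescoping sum is no larger than its largest increment,
  so \<open>a (m + t) - a m\<close> obeys the bound for step \<open>m\<close> itself. The sequence
  is Cauchy, and completeness gives the limit.\<close>

lemma padic_convergent_if_geometric:
  assumes p: "prime p" and r: "r < 1" "0 < r"
    and a: "\<And>m. padic_abs p (a (Suc m) - a m) \<le> C * r ^ m"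
  shows "\<exists>L. limitin (Qp_topology p) (\<lambda>m. rat_to_Qp p (a m)) L sequentially"
proof -
  interpret Q: Metric_space "Qp p" "Qp_dist p" by (rule Qp_complete_metric(1)[OF p])
  have C: "C \<ge> 0" using order_trans[OF padic_abs_nonneg a[of 0]] by simp
  have inc: "padic_abs p (a (m + t) - a m) \<le> C * r ^ m" for m t
  proof (induction t)
    case (Suc t)
    have "padic_abs p (a (Suc (m + t)) - a (m + t)) \<le> C * r ^ m"
      using a[of "m + t"] C r by (smt (verit) mult_left_mono power_decreasing le_add1 less_imp_le)
    then show ?case
      using Suc padic_abs_ultrametric[OF p, of "a (Suc (m + t)) - a (m + t)" "a (m + t) - a m"]
      by simp
  qed (use C r in simp)
  have "Q.MCauchy (\<lambda>m. rat_to_Qp p (a m))" unfolding Q.MCauchy_def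
  proof (intro conjI allI impI)
    show "range (\<lambda>m. rat_to_Qp p (a m)) \<subseteq> Qp p" using Qp_complete_metric(3)[OF p] by auto
    fix e :: real assume e: "e > 0"
    have "(\<lambda>m. C * r ^ m) \<longlonglongrightarrow> C * 0"
      using r by (intro tendsto_mult tendsto_const LIMSEQ_realpow_zero) auto
    then have "eventually (\<lambda>m. C * r ^ m < e) sequentially" using e by (intro order_tendstoD(2)) auto
    then obtain N where N: "C * r ^ N < e" by (auto simp: eventually_sequentially)
    have near: "padic_abs p (a m - a N) < e" if "m \<ge> N" for m
      using inc[of N "m - N"] N that by simp
    have "Qp_dist p (rat_to_Qp p (a k)) (rat_to_Qp p (a m)) < e" if "N \<le> k" "N \<le> m" for k m
      using padic_abs_ultrametric[OF p, of "a k - a N" "- (a m - a N)"] near[OF that(1)] near[OF that(2)]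
      unfolding Qp_complete_metric(4)[OF p] padic_abs_minus by simp
    then show "\<exists>N. \<forall>k m. N \<le> k \<longrightarrow> N \<le> m \<longrightarrow>
        Qp_dist p (rat_to_Qp p (a k)) (rat_to_Qp p (a m)) < e" by blast
  qed
  then show ?thesis
    using Qp_complete_metric(2)[OF p] unfolding Q.mcomplete_def Qp_topology_def by blast
qed

section \<open>Matrix entries along the walk\<close>

text \<open>Conjugation by the diagonal matrix of \<open>x\<close> scales the entry
  \<open>(k, j)\<close> by \<open>p\<close> to the power \<open>x $ k - x $ j\<close>; triangularity
  confines the sum to \<open>{i..j}\<close>.\<close>

lemma ZUT_mult_index:
  assumes p: "p > 0" and g: "g \<in> carrier (ZUT p n)" "h \<in> carrier (ZUT p n)"
  shows "l < n \<Longrightarrow> fst (g \<otimes>\<^bsub>ZUT p n\<^esub> h) $ l = fst g $ l + fst h $ l"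
    and "i < n \<Longrightarrow> j < n \<Longrightarrow> snd (g \<otimes>\<^bsub>ZUT p n\<^esub> h) $$ (i, j) =
      (\<Sum>k\<in>{i..j}. snd g $$ (i, k) * (of_nat p powi (fst g $ k - fst g $ j) * snd h $$ (k, j)))"
proof -
  obtain x f y f' where gh: "g = (x, f)" "h = (y, f')" by (metis surj_pair)
  have c: "x \<in> carrier_vec n" "y \<in> carrier_vec n" "f \<in> UT n (Z_inv p)" "f' \<in> UT n (Z_inv p)"
    using g by (auto simp: gh ZUT_def)
  show "fst (g \<otimes>\<^bsub>ZUT p n\<^esub> h) $ l = fst g $ l + fst h $ l" if "l < n"
    using that c by (simp add: gh ZUT_def)
  show "snd (g \<otimes>\<^bsub>ZUT p n\<^esub> h) $$ (i, j) =
      (\<Sum>k\<in>{i..j}. snd g $$ (i, k) * (of_nat p powi (fst g $ k - fst g $ j) * snd h $$ (k, j)))"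
    if "i < n" "j < n"
    using UT_times_index[OF c(3) diag_conj_UT[OF p c(4,1)] that] that c
    by (simp add: gh ZUT_def diag_conj_index[OF UT_D(1)] p del: index_mult_mat)
qed

lemma right_walk_closed:
  assumes "prime p" and "\<And>k. k \<ge> 1 \<Longrightarrow> z k \<in> carrier (ZUT p n)"
  shows "right_walk (ZUT p n) z m \<in> carrier (ZUT p n)"
proof -
  interpret group "ZUT p n" by (rule group_ZUT[OF assms(1)])
  show ?thesis using assms(2) by (induction m) auto
qed

lemma fst_right_walk:
  assumes "prime p" "l < n" and "\<And>k. k \<ge> 1 \<Longrightarrow> z k \<in> carrier (ZUT p n)"
  shows "fst (right_walk (ZUT p n) z m) $ l = (\<Sum>k<m. fst (z (Suc k)) $ l)"
proof (induction m)
  case 0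
  then show ?case using assms(2) by (simp add: ZUT_def)
next
  case (Suc m)
  then show ?case
    using ZUT_mult_index(1)[OF prime_gt_0_nat[OF assms(1)] right_walk_closed[OF assms(1,3)] assms(3)]
      assms(2) by simp
qed

text \<open>In the product formula the term \<open>k = j\<close> is the old entry, because the
  diagonal of a step is 1. The remaining terms form the increment, and the \<open>p\<close>-adic
  norm reverses the sign of the exponent.\<close>

lemma right_walk_increment_le:
  assumes p: "prime p" and z: "\<And>k. k \<ge> 1 \<Longrightarrow> z k \<in> carrier (ZUT p n)"
    and ij: "i < n" "j < n" "i \<le> j"
    and B: "\<And>k. i \<le> k \<Longrightarrow> k < j \<Longrightarrow>
      padic_abs p (snd (right_walk (ZUT p n) z m) $$ (i, k)) *
      (real p powr real_of_int (fst (right_walk (ZUT p n) z m) $ j - fst (right_walk (ZUT p n) z m) $ k) *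
      padic_abs p (snd (z (Suc m)) $$ (k, j))) \<le> B" and "B \<ge> 0"
  shows "padic_abs p (snd (right_walk (ZUT p n) z (Suc m)) $$ (i, j) -
    snd (right_walk (ZUT p n) z m) $$ (i, j)) \<le> B"
proof -
  let ?w = "right_walk (ZUT p n) z m"
  let ?h = "\<lambda>k. snd ?w $$ (i, k) * (of_nat p powi (fst ?w $ k - fst ?w $ j) * snd (z (Suc m)) $$ (k, j))"
  have zU: "snd (z (Suc m)) \<in> UT n (Z_inv p)" using z[of "Suc m"] by (auto simp: ZUT_def)
  have "snd (right_walk (ZUT p n) z (Suc m)) $$ (i, j) = (\<Sum>k\<in>{i..j}. ?h k)"
    using ZUT_mult_index(2)[OF prime_gt_0_nat[OF p] right_walk_closed[OF p z] z ij(1,2)] by simp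
  also have "{i..j} = insert j {i..<j}" using ij by auto
  also have "(\<Sum>k\<in>insert j {i..<j}. ?h k) = snd ?w $$ (i, j) + (\<Sum>k\<in>{i..<j}. ?h k)"
    using UT_D(5)[OF zU ij(2)] by simp
  finally have "snd (right_walk (ZUT p n) z (Suc m)) $$ (i, j) - snd ?w $$ (i, j) = (\<Sum>k\<in>{i..<j}. ?h k)"
    by simp
  also have "padic_abs p \<dots> \<le> B"
    using B \<open>B \<ge> 0\<close> by (intro padic_abs_sum_le[OF p]) (auto simp: padic_abs_mult[OF p] padic_abs_p_powi[OF p])
  finally show ?thesis .
qed

text \<open>Columns are treated from left to right: entries in earlier columns bound the increments
  in column \<open>l\<close>, and these bound the entries there. The second move relies on
  \<open>c \<le> d k\<close> and so stops before column \<open>j\<close>, for which only the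
  increments are bounded.\<close>

lemma right_walk_entry_increment_growth:
  fixes d :: "nat \<Rightarrow> real"
  assumes p: "prime p" and z: "\<And>k. k \<ge> 1 \<Longrightarrow> z k \<in> carrier (ZUT p n)"
    and drift: "\<And>e l. e > 0 \<Longrightarrow> l < n \<Longrightarrow> \<exists>C. \<forall>m.
      \<bar>real_of_int (fst (right_walk (ZUT p n) z m) $ l) - d l * real m\<bar> \<le> C + e * real m"
    and step: "\<And>e. e > 0 \<Longrightarrow> \<exists>C. \<forall>m k l. k < n \<longrightarrow> l < n \<longrightarrow>
      padic_abs p (snd (z (Suc m)) $$ (k, l)) \<le> real p powr (C + e * real m)"
    and c: "\<And>k. i \<le> k \<Longrightarrow> k < j \<Longrightarrow> c \<le> d k" and j: "j \<le> n"
  defines "w \<equiv> right_walk (ZUT p n) z"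
  shows "e > 0 \<Longrightarrow> i \<le> l \<Longrightarrow> l < n \<Longrightarrow> l \<le> j \<Longrightarrow> \<exists>C. \<forall>m.
      padic_abs p (snd (w (Suc m)) $$ (i, l) - snd (w m) $$ (i, l)) \<le> real p powr (C + (d l - c + e) * real m)"
proof -
  have p1: "real p > 1" using prime_gt_1_nat[OF p] by simp
  \<comment> \<open>The tolerance \<open>e\<close> is split into quarters: one for the earlier
    entry, one for each of the two coordinates in the exponent, one for the step.\<close>
  have increment: "\<exists>C. \<forall>m. padic_abs p (snd (w (Suc m)) $$ (i, l) - snd (w m) $$ (i, l))
      \<le> real p powr (C + (d l - c + e) * real m)"
    if e: "e > 0" and l: "i \<le> l" "l < n"
      and IH: "\<And>k. i \<le> k \<Longrightarrow> k < l \<Longrightarrow> \<exists>C. \<forall>m.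
        padic_abs p (snd (w m) $$ (i, k)) \<le> real p powr (C + (d k - c + e / 4) * real m)"
    for e l
  proof -
    have e4: "e / 4 > 0" using e by simp
    obtain C1 where C1: "\<And>k m. i \<le> k \<Longrightarrow> k < l \<Longrightarrow>
        padic_abs p (snd (w m) $$ (i, k)) \<le> real p powr (C1 k + (d k - c + e / 4) * real m)"
      using IH by metis
    obtain C2 where C2: "\<And>l m. l < n \<Longrightarrow>
        \<bar>real_of_int (fst (w m) $ l) - d l * real m\<bar> \<le> C2 l + e / 4 * real m"
      using drift[OF e4] unfolding w_def by metis
    obtain C3 where C3: "\<And>m k l. k < n \<Longrightarrow> l < n \<Longrightarrow>
        padic_abs p (snd (z (Suc m)) $$ (k, l)) \<le> real p powr (C3 + e / 4 * real m)"
      using step[OF e4] by metis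
    \<comment> \<open>The inserted 0 keeps the set nonempty for \<open>l = i\<close>, where no term
      is left.\<close>
    define C where "C = Max (insert 0 ((\<lambda>k. C1 k + C2 k + C2 l + C3) ` {i..<l}))"
    have CC: "C1 k + C2 k + C2 l + C3 \<le> C" if "i \<le> k" "k < l" for k
      unfolding C_def using that by (intro Max_ge) auto
    have "padic_abs p (snd (w (Suc m)) $$ (i, l) - snd (w m) $$ (i, l))
        \<le> real p powr (C + (d l - c + e) * real m)" for m
      unfolding w_def
    proof (rule right_walk_increment_le[OF p z])
      fix k assume k: "i \<le> k" "k < l"
      have "padic_abs p (snd (w m) $$ (i, k)) * (real p powr real_of_int (fst (w m) $ l - fst (w m) $ k) *
          padic_abs p (snd (z (Suc m)) $$ (k, l)))
        \<le> real p powr (C1 k + (d k - c + e / 4) * real m) *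
          (real p powr ((C2 l + C2 k) + (d l - d k + e / 2) * real m) * real p powr (C3 + e / 4 * real m))"
      proof (intro mult_mono C1 C3 powr_mono)
        show "real_of_int (fst (w m) $ l - fst (w m) $ k) \<le> (C2 l + C2 k) + (d l - d k + e / 2) * real m"
          using C2[of l m] C2[of k m] k l by (simp add: algebra_simps)
      qed (use k l p1 in auto)
      also have "\<dots> = real p powr ((C1 k + C2 k + C2 l + C3) + (d l - c + e) * real m)"
        by (simp add: powr_add[symmetric] algebra_simps add_divide_distrib)
      also have "\<dots> \<le> real p powr (C + (d l - c + e) * real m)"
        using CC[OF k] p1 by (intro powr_mono) auto
      finally show "padic_abs p (snd (right_walk (ZUT p n) z m) $$ (i, k)) *
          (real p powr real_of_int (fst (right_walk (ZUT p n) z m) $ l - fst (right_walk (ZUT p n) z m) $ k) *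
          padic_abs p (snd (z (Suc m)) $$ (k, l))) \<le> real p powr (C + (d l - c + e) * real m)"
        unfolding w_def .
    qed (use l in auto)
    then show ?thesis by blast
  qed
  have growth: "\<exists>C. \<forall>m. padic_abs p (snd (w m) $$ (i, k)) \<le> real p powr (C + (d k - c + e) * real m)"
    if "e > 0" "i \<le> k" "k < j" for e k
    using that
  \<comment> \<open>The tolerance is generalised because earlier columns are used with a quarter of
    it.\<close>
  proof (induction k arbitrary: e rule: less_induct)
    case (less k)
    have kn: "k < n" using less.prems j by simp
    have "e / 4 > 0" using less.prems by simp
    then obtain C where C: "\<And>m. padic_abs p (snd (w (Suc m)) $$ (i, k) - snd (w m) $$ (i, k))
        \<le> real p powr (C + (d k - c + e) * real m)"
      using increment[OF less.prems(1,2) kn] less.IH less.prems by (meson less_trans)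
    \<comment> \<open>The walk starts at the identity, whose entries have norm at most 1;
      \<open>max 0 C\<close> accommodates this start.\<close>
    have "padic_abs p (snd (w m) $$ (i, k)) \<le> real p powr (max 0 C + (d k - c + e) * real m)" for m
    proof (induction m)
      case 0
      have "padic_abs p (snd (w 0) $$ (i, k)) \<le> 1"
        using kn less.prems padic_abs_1[OF p] by (simp add: w_def ZUT_def)
      also have "1 \<le> real p powr max 0 C" using p1 by (intro ge_one_powr_ge_zero) auto
      finally show ?case by simp
    next
      case (Suc m)
      \<comment> \<open>The rate is nonnegative since \<open>c \<le> d k\<close>. The bound
        therefore does not decrease in \<open>m\<close>, and the maximum of old entry and increment
        stays below it.\<close>
      have "(d k - c + e) * real m \<le> (d k - c + e) * real (Suc m)"
        using c[OF less.prems(2,3)] less.prems(1) by (intro mult_left_mono) auto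
      then have "real p powr (C + (d k - c + e) * real m) \<le> real p powr (max 0 C + (d k - c + e) * real (Suc m))"
        "real p powr (max 0 C + (d k - c + e) * real m) \<le> real p powr (max 0 C + (d k - c + e) * real (Suc m))"
        using p1 by (auto intro!: powr_mono add_mono)
      then show ?case
        using padic_abs_ultrametric[OF p, of "snd (w (Suc m)) $$ (i, k) - snd (w m) $$ (i, k)" "snd (w m) $$ (i, k)"]
          C[of m] Suc by (auto simp: max_def split: if_splits)
    qed
    then show ?case by blast
  qed
  show "\<exists>C. \<forall>m. padic_abs p (snd (w (Suc m)) $$ (i, l) - snd (w m) $$ (i, l))
      \<le> real p powr (C + (d l - c + e) * real m)" if "e > 0" "i \<le> l" "l < n" "l \<le> j"
    using that by (intro increment growth) auto
qed

lemma right_walk_entry_convergent: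
  fixes d :: "nat \<Rightarrow> real"
  assumes p: "prime p" and z: "\<And>k. k \<ge> 1 \<Longrightarrow> z k \<in> carrier (ZUT p n)"
    and drift: "\<And>e l. e > 0 \<Longrightarrow> l < n \<Longrightarrow> \<exists>C. \<forall>m.
      \<bar>real_of_int (fst (right_walk (ZUT p n) z m) $ l) - d l * real m\<bar> \<le> C + e * real m"
    and step: "\<And>e. e > 0 \<Longrightarrow> \<exists>C. \<forall>m k l. k < n \<longrightarrow> l < n \<longrightarrow>
      padic_abs p (snd (z (Suc m)) $$ (k, l)) \<le> real p powr (C + e * real m)"
    and ij: "i < j" "j < n" and d: "\<And>k. i \<le> k \<Longrightarrow> k < j \<Longrightarrow> d j < d k"
  shows "\<exists>L. limitin (Qp_topology p)
    (\<lambda>m. rat_to_Qp p (snd (right_walk (ZUT p n) z m) $$ (i, j))) L sequentially"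
proof -
  have p1: "real p > 1" using prime_gt_1_nat[OF p] by simp
  define c where "c = Min (d ` {i..<j})"
  have c: "c \<le> d k" if "i \<le> k" "k < j" for k
    unfolding c_def using that by (intro Min_le) auto
  \<comment> \<open>The minimum is attained, as \<open>i < j\<close>; hence the strict inequalities
    pass to \<open>c\<close>.\<close>
  have "c \<in> d ` {i..<j}" unfolding c_def using ij by (intro Min_in) auto
  then have cj: "c > d j" using d by auto
  \<comment> \<open>Half the gap turns the rate \<open>d j - c + e\<close> into \<open>- e\<close>,
    so the increments decay geometrically.\<close>
  define e where "e = (c - d j) / 2"
  have e: "e > 0" using cj by (simp add: e_def)
  have "\<exists>C. \<forall>m. padic_abs p (snd (right_walk (ZUT p n) z (Suc m)) $$ (i, j)
      - snd (right_walk (ZUT p n) z m) $$ (i, j)) \<le> real p powr (C + (d j - c + e) * real m)"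
    by (rule right_walk_entry_increment_growth[OF p z drift step c]) (use ij e in auto)
  then obtain C where C: "\<And>m. padic_abs p (snd (right_walk (ZUT p n) z (Suc m)) $$ (i, j)
      - snd (right_walk (ZUT p n) z m) $$ (i, j)) \<le> real p powr (C + (d j - c + e) * real m)"
    by blast
  show ?thesis
  proof (rule padic_convergent_if_geometric[OF p])
    show "real p powr (- e) < 1" "0 < real p powr (- e)"
      using p1 e powr_less_mono[of "- e" 0 "real p"] by auto
    have "d j - c + e = - e" by (simp add: e_def field_simps)
    then have "real p powr (C + (d j - c + e) * real m) = real p powr C * (real p powr - e) ^ m" for m
      using p1 by (simp only:) (simp add: powr_power powr_add[symmetric] mult.commute)
    then show "padic_abs p (snd (right_walk (ZUT p n) z (Suc m)) $$ (i, j)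
      - snd (right_walk (ZUT p n) z m) $$ (i, j)) \<le> real p powr C * (real p powr - e) ^ m" for m
      using C[of m] by simp
  qed
qed

section \<open>Word length\<close>

text \<open>Guarantees that the \<open>LEAST\<close> in \<open>word_length\<close> ranges over a
  nonempty set. Products in \<open>generate\<close> correspond to concatenated words.\<close>

lemma ex_word_of_generate:
  assumes "group G" "S \<subseteq> carrier G" "g \<in> generate G S"
  shows "\<exists>ws. set ws \<subseteq> S \<union> m_inv G ` S \<and> foldr (monoid.mult G) ws (one G) = g"
proof -
  interpret group G by fact
  have T: "S \<union> m_inv G ` S \<subseteq> carrier G" using assms(2) by auto
  have closed: "foldr (monoid.mult G) ws (one G) \<in> carrier G" if "set ws \<subseteq> S \<union> m_inv G ` S" for ws
    using that T by (induction ws) auto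
  have app: "foldr (monoid.mult G) (us @ vs) (one G) =
      foldr (monoid.mult G) us (one G) \<otimes>\<^bsub>G\<^esub> foldr (monoid.mult G) vs (one G)"
    if "set us \<subseteq> S \<union> m_inv G ` S" "set vs \<subseteq> S \<union> m_inv G ` S" for us vs
    using that(1)
  proof (induction us)
    case (Cons u us)
    have "u \<in> carrier G" "set us \<subseteq> S \<union> m_inv G ` S" using Cons.prems T by auto
    then show ?case using Cons.IH closed[of us] closed[OF that(2)] by (simp add: m_assoc)
  qed (use closed that(2) in simp)
  show ?thesis using assms(3)
  proof (induction g rule: generate.induct)
    case one
    show ?case by (intro exI[of _ "[]"]) auto
  next
    case (incl h)
    then show ?case using assms(2) by (intro exI[of _ "[h]"]) auto
  next
    case (inv h)
    then show ?case using assms(2) by (intro exI[of _ "[inv\<^bsub>G\<^esub> h]"]) auto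
  next
    case (eng h1 h2)
    then obtain us vs where "set us \<subseteq> S \<union> m_inv G ` S" "foldr (monoid.mult G) us (one G) = h1"
      "set vs \<subseteq> S \<union> m_inv G ` S" "foldr (monoid.mult G) vs (one G) = h2" by blast
    then show ?case using app[of us vs] by (intro exI[of _ "us @ vs"]) auto
  qed
qed

lemma ex_word_of_length:
  assumes "group G" "S \<subseteq> carrier G" "g \<in> generate G S"
  shows "\<exists>ws. length ws = word_length G S g \<and> set ws \<subseteq> S \<union> m_inv G ` S \<and>
     foldr (monoid.mult G) ws (one G) = g"
  unfolding word_length_def by (rule LeastI_ex) (use ex_word_of_generate[OF assms] in blast)

lemma finite_carrier_ZUT_bound:
  assumes p: "prime p" and T: "finite T"
  shows "\<exists>K\<ge>0. \<forall>t\<in>T. (\<forall>l<n. real_of_int \<bar>fst t $ l\<bar> \<le> K) \<and>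
    (\<forall>k<n. \<forall>l<n. padic_abs p (snd t $$ (k, l)) \<le> real p powr K)"
proof -
  have p1: "real p > 1" using prime_gt_1_nat[OF p] by simp
  define X where "X = (\<lambda>(t, l). real_of_int \<bar>fst t $ l\<bar>) ` (T \<times> {..<n})"
  define Y where "Y = (\<lambda>(t, k, l). log p (padic_abs p (snd t $$ (k, l)))) ` (T \<times> {..<n} \<times> {..<n})"
  \<comment> \<open>The inserted 0 yields \<open>K \<ge> 0\<close>. The logarithms in
    \<open>Y\<close> are used for nonzero entries only.\<close>
  define K where "K = Max (insert 0 (X \<union> Y))"
  have fin: "finite (insert 0 (X \<union> Y))" using T by (simp add: X_def Y_def)
  have K: "a \<le> K" if "a \<in> insert 0 (X \<union> Y)" for a
    unfolding K_def using fin that by (rule Max_ge)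
  show ?thesis
  proof (intro exI[of _ K] conjI ballI allI impI)
    fix t l assume "t \<in> T" "l < n"
    then show "real_of_int \<bar>fst t $ l\<bar> \<le> K" by (intro K) (force simp: X_def)
  next
    fix t k l assume tkl: "t \<in> T" "k < n" "l < n"
    show "padic_abs p (snd t $$ (k, l)) \<le> real p powr K"
    proof (cases "snd t $$ (k, l) = 0")
      case False
      have "log p (padic_abs p (snd t $$ (k, l))) \<le> K" using tkl by (intro K) (force simp: Y_def)
      then show ?thesis using p1 padic_abs_pos[OF p False] by (simp add: log_le_iff)
    qed simp
  qed (rule K, simp)
qed

text \<open>Letters are prepended, so the conjugation involves the coordinates of a single letter.
  Each letter costs a factor \<open>p\<close> to the power \<open>3 * K\<close>: \<open>K\<close>
  from its own entry and \<open>2 * K\<close> from the difference of two of its coordinates.\<close>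

lemma word_ZUT_bound:
  assumes p: "prime p" and T: "T \<subseteq> carrier (ZUT p n)" and K: "K \<ge> 0"
    "\<And>t l. t \<in> T \<Longrightarrow> l < n \<Longrightarrow> real_of_int \<bar>fst t $ l\<bar> \<le> K"
    "\<And>t k l. t \<in> T \<Longrightarrow> k < n \<Longrightarrow> l < n \<Longrightarrow> padic_abs p (snd t $$ (k, l)) \<le> real p powr K"
    and ws: "set ws \<subseteq> T"
  defines "g \<equiv> foldr (monoid.mult (ZUT p n)) ws (one (ZUT p n))"
  shows "l < n \<Longrightarrow> real_of_int \<bar>fst g $ l\<bar> \<le> K * real (length ws)"
    and "k < n \<Longrightarrow> l < n \<Longrightarrow> padic_abs p (snd g $$ (k, l)) \<le> real p powr (3 * K * real (length ws))"
proof -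
  interpret group "ZUT p n" by (rule group_ZUT[OF p])
  have p1: "real p > 1" using prime_gt_1_nat[OF p] by simp
  have "g \<in> carrier (ZUT p n) \<and> (\<forall>l<n. real_of_int \<bar>fst g $ l\<bar> \<le> K * real (length ws)) \<and>
    (\<forall>k<n. \<forall>l<n. padic_abs p (snd g $$ (k, l)) \<le> real p powr (3 * K * real (length ws)))"
    unfolding g_def using ws
  proof (induction ws)
    case Nil
    then show ?case using padic_abs_1[OF p] p1 by (auto simp: ZUT_def UT_one)
  next
    case (Cons t ws)
    let ?h = "foldr (monoid.mult (ZUT p n)) ws (one (ZUT p n))"
    have t: "t \<in> T" "t \<in> carrier (ZUT p n)" using Cons.prems T by auto
    have h: "?h \<in> carrier (ZUT p n)" "\<And>l. l < n \<Longrightarrow> real_of_int \<bar>fst ?h $ l\<bar> \<le> K * real (length ws)"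
      "\<And>k l. k < n \<Longrightarrow> l < n \<Longrightarrow> padic_abs p (snd ?h $$ (k, l)) \<le> real p powr (3 * K * real (length ws))"
      using Cons by auto
    have p0: "p > 0" using p by (rule prime_gt_0_nat)
    have "real_of_int \<bar>fst (t \<otimes>\<^bsub>ZUT p n\<^esub> ?h) $ l\<bar> \<le> K * real (length (t # ws))" if "l < n" for l
      using K(2)[OF t(1) that] h(2)[OF that] that
      by (simp add: ZUT_mult_index(1)[OF p0 t(2) h(1)] algebra_simps)
    moreover have "padic_abs p (snd (t \<otimes>\<^bsub>ZUT p n\<^esub> ?h) $$ (k, l)) \<le> real p powr (3 * K * real (length (t # ws)))"
      if kl: "k < n" "l < n" for k l
      unfolding ZUT_mult_index(2)[OF p0 t(2) h(1) kl]
    proof (rule padic_abs_sum_le[OF p])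
      fix r assume r: "r \<in> {k..l}"
      then have r: "r < n" using kl by simp
      have "padic_abs p (snd t $$ (k, r) * (of_nat p powi (fst t $ r - fst t $ l) * snd ?h $$ (r, l)))
        = padic_abs p (snd t $$ (k, r)) *
          (real p powr - real_of_int (fst t $ r - fst t $ l) * padic_abs p (snd ?h $$ (r, l)))"
        by (simp only: padic_abs_mult[OF p] padic_abs_p_powi[OF p])
      also have "\<dots> \<le> real p powr K * (real p powr (2 * K) * real p powr (3 * K * real (length ws)))"
      proof (intro mult_mono powr_mono K(3) h(3))
        show "- real_of_int (fst t $ r - fst t $ l) \<le> 2 * K"
          using K(2)[OF t(1) r] K(2)[OF t(1) kl(2)] by simp
      qed (use t r kl p1 in auto)
      also have "\<dots> = real p powr (3 * K * real (length (t # ws)))"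
        by (simp add: powr_add[symmetric] algebra_simps)
      finally show "padic_abs p (snd t $$ (k, r) * (of_nat p powi (fst t $ r - fst t $ l) * snd ?h $$ (r, l)))
        \<le> real p powr (3 * K * real (length (t # ws)))" .
    qed simp
    ultimately show ?case using m_closed[OF t(2) h(1)] by simp
  qed
  then show "l < n \<Longrightarrow> real_of_int \<bar>fst g $ l\<bar> \<le> K * real (length ws)"
    and "k < n \<Longrightarrow> l < n \<Longrightarrow> padic_abs p (snd g $$ (k, l)) \<le> real p powr (3 * K * real (length ws))"
    by auto
qed

text \<open>Applied to a shortest word, the preceding bound transfers moment and growth control from
  word length to coordinates and to logarithms of entry norms.\<close>

lemma word_length_ZUT_bound:
  assumes p: "prime p" and S: "finite S" "S \<subseteq> carrier (ZUT p n)" "generate (ZUT p n) S = carrier (ZUT p n)"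
  shows "\<exists>K\<ge>0. \<forall>g\<in>carrier (ZUT p n).
    (\<forall>l<n. real_of_int \<bar>fst g $ l\<bar> \<le> K * real (word_length (ZUT p n) S g)) \<and>
    (\<forall>k<n. \<forall>l<n. padic_abs p (snd g $$ (k, l)) \<le> real p powr (K * real (word_length (ZUT p n) S g)))"
proof -
  interpret group "ZUT p n" by (rule group_ZUT[OF p])
  define T where "T = S \<union> m_inv (ZUT p n) ` S"
  have T: "finite T" "T \<subseteq> carrier (ZUT p n)" using S by (auto simp: T_def)
  obtain K where K: "K \<ge> 0" "\<And>t l. t \<in> T \<Longrightarrow> l < n \<Longrightarrow> real_of_int \<bar>fst t $ l\<bar> \<le> K"
    "\<And>t k l. t \<in> T \<Longrightarrow> k < n \<Longrightarrow> l < n \<Longrightarrow> padic_abs p (snd t $$ (k, l)) \<le> real p powr K"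
    using finite_carrier_ZUT_bound[OF p T(1), of n] by blast
  show ?thesis
  \<comment> \<open>The entries require \<open>3 * K\<close>; the coordinates would do with
    \<open>K\<close>.\<close>
  proof (intro exI[of _ "3 * K"] conjI ballI)
    fix g assume "g \<in> carrier (ZUT p n)"
    then obtain ws where ws: "length ws = word_length (ZUT p n) S g" "set ws \<subseteq> T"
      "foldr (monoid.mult (ZUT p n)) ws (one (ZUT p n)) = g"
      using ex_word_of_length[OF is_group S(2)] unfolding S(3) T_def by blast
    have B: "real_of_int \<bar>fst g $ l\<bar> \<le> K * real (word_length (ZUT p n) S g)" if "l < n" for l
      by (rule word_ZUT_bound(1)[OF p T(2) K ws(2) that, unfolded ws(3) ws(1)])
    show "\<forall>l<n. real_of_int \<bar>fst g $ l\<bar> \<le> 3 * K * real (word_length (ZUT p n) S g)"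
    proof (intro allI impI)
      fix l assume "l < n"
      have "0 \<le> K * real (word_length (ZUT p n) S g)" using K(1) by simp
      with B[OF \<open>l < n\<close>] show "real_of_int \<bar>fst g $ l\<bar> \<le> 3 * K * real (word_length (ZUT p n) S g)"
        by simp
    qed
    show "\<forall>k<n. \<forall>l<n. padic_abs p (snd g $$ (k, l)) \<le> real p powr (3 * K * real (word_length (ZUT p n) S g))"
      by (intro allI impI word_ZUT_bound(2)[OF p T(2) K ws(2), unfolded ws(3) ws(1)])
  qed (use K in simp)
qed

section \<open>Convergence of the random walk\<close>

text \<open>Moves the strong law from real variables to functionals of the steps, with mean and
  integrability read off from \<open>\<mu>\<close>.\<close>

lemma (in prob_space) iid_functional_sums_linear:
  fixes Z :: "nat \<Rightarrow> 'a \<Rightarrow> 'b" and h :: "'b \<Rightarrow> real"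
  assumes indep: "indep_vars (\<lambda>_. count_space UNIV) Z {1..}"
    and law: "\<And>k. k \<ge> 1 \<Longrightarrow> distr M (count_space UNIV) (Z k) = measure_pmf \<mu>"
    and int: "integrable (measure_pmf \<mu>) h"
  shows "AE \<omega> in M. \<forall>e>0. \<exists>C. \<forall>m.
    \<bar>(\<Sum>k<m. h (Z (Suc k) \<omega>)) - measure_pmf.expectation \<mu> h * real m\<bar> \<le> C + e * real m"
proof -
  have Zm: "Z (Suc k) \<in> measurable M (count_space UNIV)" for k
    using indep by (simp add: indep_vars_def)
  have law': "distr M (count_space UNIV) (Z (Suc k)) = measure_pmf \<mu>" for k by (rule law) simp
  have "indep_vars (\<lambda>_. count_space UNIV) (\<lambda>k. Z (Suc k)) UNIV"
    by (rule indep_vars_reindex_inj) (auto intro: indep_vars_subset[OF indep])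
  then have ind: "indep_vars (\<lambda>_. borel) (\<lambda>k \<omega>. h (Z (Suc k) \<omega>)) UNIV"
    by (rule indep_vars_compose2) simp
  have "distr M borel (\<lambda>\<omega>. h (Z (Suc k) \<omega>)) = distr (measure_pmf \<mu>) borel h" for k
    unfolding law'[of k, symmetric] by (subst distr_distr) (auto simp: Zm comp_def)
  moreover have "integrable M (\<lambda>\<omega>. h (Z (Suc 0) \<omega>))"
    using int unfolding law'[of 0, symmetric] by (subst (asm) integrable_distr_eq) (auto simp: Zm)
  moreover have "expectation (\<lambda>\<omega>. h (Z (Suc 0) \<omega>)) = measure_pmf.expectation \<mu> h"
    unfolding law'[of 0, symmetric] by (subst integral_distr) (auto simp: Zm)
  ultimately show ?thesis using iid_partial_sums_linear[OF ind] by simp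
qed

theorem proposition6p2p5:
  fixes p n i j :: nat
    and \<mu> :: "(int Matrix.vec \<times> rat mat) pmf"
    and S :: "(int Matrix.vec \<times> rat mat) set"
    and W :: "'w measure"
    and Z :: "nat \<Rightarrow> 'w \<Rightarrow> int Matrix.vec \<times> rat mat"
  assumes "prime p"
    and "set_pmf \<mu> \<subseteq> carrier (ZUT p n)"
    and "finite S" and "S \<subseteq> carrier (ZUT p n)" and "generate (ZUT p n) S = carrier (ZUT p n)"
    and "integrable (measure_pmf \<mu>) (\<lambda>g. real (word_length (ZUT p n) S g))"
    and "\<not> comm_group (subgroup_generated (ZUT p n) (set_pmf \<mu>))"
    and "i < j" and "j < n"
    and "displacement n \<mu> $$ (i, j) > 0"
    and "\<And>k. i < k \<Longrightarrow> k < j \<Longrightarrow>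
      sgn (displacement n \<mu> $$ (i, j)) = sgn (displacement n \<mu> $$ (k, j))"
    and "prob_space W"
    and "prob_space.indep_vars W (\<lambda>_. count_space UNIV) Z {1..}"
    and "\<And>k. k \<ge> 1 \<Longrightarrow> distr W (count_space UNIV) (Z k) = measure_pmf \<mu>"
  shows "AE \<omega> in W. \<exists>L. limitin (Qp_topology p)
    (\<lambda>m. rat_to_Qp p (snd (right_walk (ZUT p n) (\<lambda>k. Z k \<omega>) m) $$ (i, j))) L sequentially"
proof -
  interpret W: prob_space W by fact
  note p = assms(1) and law = assms(14)
  have p1: "real p > 1" using prime_gt_1_nat[OF p] by simp
  let ?len = "\<lambda>g. real (word_length (ZUT p n) S g)"
  obtain K where K: "K \<ge> 0"
    "\<And>g l. g \<in> carrier (ZUT p n) \<Longrightarrow> l < n \<Longrightarrow> real_of_int \<bar>fst g $ l\<bar> \<le> K * ?len g"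
    "\<And>g k l. g \<in> carrier (ZUT p n) \<Longrightarrow> k < n \<Longrightarrow> l < n \<Longrightarrow>
      padic_abs p (snd g $$ (k, l)) \<le> real p powr (K * ?len g)"
    using word_length_ZUT_bound[OF p assms(3-5)] by blast
  define d where "d = (\<lambda>l. first_moment (coord_law \<mu> l))"
  have d: "d l = measure_pmf.expectation \<mu> (\<lambda>g. real_of_int (fst g $ l))" for l
    by (simp add: d_def first_moment_def coord_law_def case_prod_unfold)
  \<comment> \<open>For \<open>k = i\<close> this is the positivity of the entry
    \<open>(i, j)\<close>; for the other \<open>k\<close> the sign condition passes positivity
    on.\<close>
  have dk: "d j < d k" if "i \<le> k" "k < j" for k
  proof -
    have "displacement n \<mu> $$ (k, j) > 0"
      using assms(10) assms(11)[of k] that by (cases "k = i") (auto simp: sgn_if split: if_splits)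
    then show ?thesis using that assms(9) by (simp add: displacement_def d_def)
  qed
  \<comment> \<open>Coordinates are dominated by a multiple of the word length, which has finite
    mean.\<close>
  have int: "integrable (measure_pmf \<mu>) (\<lambda>g. real_of_int (fst g $ l))" if "l < n" for l
  proof (rule Bochner_Integration.integrable_bound)
    show "integrable (measure_pmf \<mu>) (\<lambda>g. K * ?len g)" using assms(6) by simp
    show "AE g in measure_pmf \<mu>. norm (real_of_int (fst g $ l)) \<le> norm (K * ?len g)"
      using K(1) K(2)[OF _ that] assms(2) by (auto simp: AE_measure_pmf_iff)
  qed simp
  have "AE \<omega> in W. Z (Suc k) \<omega> \<in> carrier (ZUT p n)" for k
  proof -
    have m: "Z (Suc k) \<in> measurable W (count_space UNIV)"
      using assms(13) by (simp add: W.indep_vars_def)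
    have "AE g in distr W (count_space UNIV) (Z (Suc k)). g \<in> carrier (ZUT p n)"
      by (subst law) (use assms(2) in \<open>auto simp: AE_measure_pmf_iff\<close>)
    then show ?thesis using AE_distrD[OF m] by blast
  qed
  then have "AE \<omega> in W. \<forall>k. Z (Suc k) \<omega> \<in> carrier (ZUT p n)" by (simp add: AE_all_countable)
  moreover have "AE \<omega> in W. \<forall>e>0. \<exists>C. \<forall>m.
    \<bar>(\<Sum>k<m. ?len (Z (Suc k) \<omega>)) - measure_pmf.expectation \<mu> ?len * real m\<bar> \<le> C + e * real m"
    by (rule W.iid_functional_sums_linear[OF assms(13) law assms(6)])
  moreover have "AE \<omega> in W. \<forall>l\<in>{..<n}. \<forall>e>0. \<exists>C. \<forall>m.
    \<bar>(\<Sum>k<m. real_of_int (fst (Z (Suc k) \<omega>) $ l)) - d l * real m\<bar> \<le> C + e * real m"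
    unfolding d
    by (intro AE_finite_allI W.iid_functional_sums_linear[OF assms(13) law int]) auto
  ultimately show ?thesis
  proof eventually_elim
    case (elim \<omega>)
    define z where "z = (\<lambda>k. Z k \<omega>)"
    have z: "z k \<in> carrier (ZUT p n)" if "k \<ge> 1" for k
      using elim(1) that unfolding z_def by (cases k) auto
    have walk: "fst (right_walk (ZUT p n) z m) $ l = (\<Sum>k<m. fst (z (Suc k)) $ l)" if "l < n" for l m
      by (rule fst_right_walk[OF p that z])
    show ?case
      unfolding z_def[symmetric]
    proof (rule right_walk_entry_convergent[OF p z, where d = d])
      fix e :: real and l assume "e > 0" "l < n"
      then show "\<exists>C. \<forall>m. \<bar>real_of_int (fst (right_walk (ZUT p n) z m) $ l) - d l * real m\<bar> \<le> C + e * real m"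
        using elim(3) unfolding walk[OF \<open>l < n\<close>] of_int_sum unfolding z_def by blast
    next
      fix e :: real assume e: "e > 0"
      \<comment> \<open>Chosen so that \<open>2 * K * e' \<le> e\<close>; the summand 1 avoids
        division by zero when \<open>K = 0\<close>.\<close>
      define e' where "e' = e / (2 * (K + 1))"
      have e': "e' > 0" "2 * K * e' \<le> e" using e K(1) by (auto simp: e'_def field_simps)
      define E where "E = measure_pmf.expectation \<mu> ?len"
      obtain C where C: "\<And>m. \<bar>(\<Sum>k<m. ?len (z (Suc k))) - E * real m\<bar> \<le> C + e' * real m"
        using elim(2) e'(1) unfolding z_def E_def by blast
      \<comment> \<open>A single length is the difference of consecutive partial sums. The two error
        terms add up to \<open>2 * C + e' + 2 * e' * real m\<close>, and the mean contributes one
        \<open>E\<close>.\<close>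
      have len: "?len (z (Suc m)) \<le> (2 * C + e' + E) + 2 * e' * real m" for m
        using C[of m] C[of "Suc m"] by (simp add: algebra_simps abs_le_iff)
      show "\<exists>C. \<forall>m k l. k < n \<longrightarrow> l < n \<longrightarrow>
        padic_abs p (snd (z (Suc m)) $$ (k, l)) \<le> real p powr (C + e * real m)"
      proof (intro exI allI impI)
        fix m k l assume kl: "k < n" "l < n"
        have "K * ?len (z (Suc m)) \<le> K * ((2 * C + e' + E) + 2 * e' * real m)"
          using len[of m] K(1) by (rule mult_left_mono)
        also have "\<dots> = K * (2 * C + e' + E) + (2 * K * e') * real m" by (simp add: algebra_simps)
        also have "\<dots> \<le> K * (2 * C + e' + E) + e * real m"
          using e'(2) by (intro add_left_mono mult_right_mono) auto
        finally have "real p powr (K * ?len (z (Suc m))) \<le> real p powr (K * (2 * C + e' + E) + e * real m)"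
          using p1 by (intro powr_mono) auto
        then show "padic_abs p (snd (z (Suc m)) $$ (k, l)) \<le> real p powr (K * (2 * C + e' + E) + e * real m)"
          using K(3)[OF z kl, of "Suc m"] by simp
      qed
    qed (use assms(8,9) dk in auto)
  qed
qed

end
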